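(* Let $\nu>-\frac12$, $s,\tau\in\mathbb R$, $\sigma=2^{2/3}(2s-\tau^2)$ and $z\in\mathbb C\setminus(-\infty,0]$. The $4\times 4$ matrix functions $M_\nu$ and $M_{\nu+1}$ (defined in the context) satisfy $$M_{\nu+1}(z;s,\tau)=\Bigl(I+\frac{\alpha_\nu}{z}R_\nu\Bigr)\Sigma\,M_\nu(z;s,\tau)\,\Sigma,$$ where $$R_\nu=\begin{pmatrix}\beta_\nu&\beta_\nu&-i&i\\-\beta_\nu&-\beta_\nu&i&-i\\i\gamma_\nu&i\gamma_\nu&-\delta_\nu&\delta_\nu\\i\gamma_\nu&i\gamma_\nu&-\delta_\nu&\delta_\nu\end{pmatrix},\qquad\Sigma=\mathrm{diag}(1,-1,1,-1),$$ and, with $q_\nu=q_\nu(\sigma)$, $q_\nu'=q_\nu'(\sigma)$, $u_\nu=u_\nu(\sigma)$, $$\alpha_\nu=2^{-1/3}(q_{\nu+1}+q_\nu)=2^{-1/3}(u_{\nu+1}-u_\nu)=\frac{2^{-1/3}(2\nu+1)}{2q_\nu^2-2q_\nu'+2^{5/3}s-2^{2/3}\tau^2},$$ $$\beta_\nu=s^2+\tau-2^{-1/3}(q_\nu+u_\nu),\qquad \delta_\nu=s^2-\tau-2^{-1/3}(q_\nu+u_\nu),$$ $$\gamma_\nu=2^{-2/3}(q_\nu^2-u_\nu^2)+2^{2/3}s^2(q_\nu+u_\nu)-2^{1/3}(q_\nu u_\nu+q_\nu')+2s-s^4.$$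
   Context: **Painlevé II.** For $\nu>-1/2$ let $q_\nu$ be the Hastings–McLeod solution of $q''(\sigma)=2q(\sigma)^3+\sigma q(\sigma)-\nu$, i.e. the solution with $q_\nu(\sigma)\sim\nu/\sigma$ as $\sigma\to+\infty$ (for $\nu=0$: $q_0(\sigma)\sim\mathrm{Ai}(\sigma)$) and $q_\nu(\sigma)\sim\sqrt{-\sigma/2}$ as $\sigma\to-\infty$. Let $u_\nu(\sigma)=q_\nu'(\sigma)^2-\sigma q_\nu(\sigma)^2-q_\nu(\sigma)^4+2\nu q_\nu(\sigma)$. **The matrix $M_\nu$.** For $s,\tau\in\mathbb R$ put $\sigma=2^{2/3}(2s-\tau^2)$ and $$c=-2^{-1/3}u_\nu(\sigma)+s^2,\quad d=2^{-1/3}q_\nu(\sigma),\quad G=-c^2+d^2+s,\quad H=-2^{1/3}\bigl(q_\nu'(\sigma)+q_\nu(\sigma)u_\nu(\sigma)\bigr)+2^{2/3}s^2q_\nu(\sigma).$$ $M_\nu(z;s,\tau)$, $z\in\mathbb C\setminus(-\infty,0]$, is the $4\times4$ matrix solution (it is known to exist and be unique) of $$\frac{\partial M_\nu}{\partial z}=U_\nu M_\nu,\qquad U_\nu=\begin{pmatrix}-c+\tau&d+\frac\nu z&i&0\\-d+\frac\nu z&c-\tau&0&i\\-i(-z+G+s)&-iH&c+\tau&d-\frac\nu z\\-iH&-i(z+G+s)&-d-\frac\nu z&-c-\tau\end{pmatrix}$$ such that, as $z\to\infty$ in the sector $-\pi/12<\arg z<7\pi/12$, $$M_\nu(z)=\bigl(I+M_{\nu,1}z^{-1}+O(z^{-2})\bigr)\,\mathrm{diag}\bigl((-z)^{-1/4},z^{-1/4},(-z)^{1/4},z^{1/4}\bigr)\,\mathcal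 A\,\mathrm{diag}\bigl(e^{-\theta_1+\tau z},e^{-\theta_2-\tau z},e^{\theta_1+\tau z},e^{\theta_2-\tau z}\bigr)$$ for some matrix $M_{\nu,1}$ independent of $z$, where $\theta_1(z)=\frac23(-z)^{3/2}+2s(-z)^{1/2}$, $\theta_2(z)=\frac23z^{3/2}+2sz^{1/2}$, $$\mathcal A=\frac1{\sqrt2}\begin{pmatrix}1&0&-i&0\\0&1&0&i\\-i&0&1&0\\0&i&0&1\end{pmatrix},$$ $z^p$ is the principal branch, and $(-z)^p=e^{-ip\pi}z^p$ (the principal branch of $(-z)^p$ for $\Im z>0$, continued analytically). *)

theory Defs
  imports "HOL-Analysis.Analysis" "HOL-Library.Landau_Symbols"
begin

text \<open>
  The improper integral defining the Airy function converges only conditionally for real arguments.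
  The Henstock--Kurzweil integral used here covers that case: over the unbounded set \<^term>\<open>{0..}\<close>
  it is by definition a limit of integrals over bounded intervals.
\<close>

definition airy_Ai :: "real \<Rightarrow> real" where
  "airy_Ai x = 1 / pi * integral {0..} (\<lambda>t. cos (t ^ 3 / 3 + x * t))"

text \<open>
  \<open>hastings_mcleod \<nu> q\<close> says that \<open>q\<close> is the function \<open>q\<^sub>\<nu>\<close>. The solution is real and has no poles on
  the real line.
\<close>

definition hastings_mcleod :: "real \<Rightarrow> (real \<Rightarrow> real) \<Rightarrow> bool" where
  "hastings_mcleod \<nu> q \<longleftrightarrow>
     (\<forall>\<sigma>. (q has_real_derivative deriv q \<sigma>) (at \<sigma>)) \<and>
     (\<forall>\<sigma>. (deriv q has_real_derivative 2 * q \<sigma> ^ 3 + \<sigma> * q \<sigma> - \<nu>) (at \<sigma>)) \<and>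
     asymp_equiv q at_top (\<lambda>\<sigma>. if \<nu> = 0 then airy_Ai \<sigma> else \<nu> / \<sigma>) \<and>
     asymp_equiv q at_bot (\<lambda>\<sigma>. sqrt (- \<sigma> / 2))"

definition pII_u :: "real \<Rightarrow> (real \<Rightarrow> real) \<Rightarrow> real \<Rightarrow> real" where
  "pII_u \<nu> q \<sigma> = (deriv q \<sigma>)^2 - \<sigma> * (q \<sigma>)^2 - (q \<sigma>)^4 + 2 * \<nu> * q \<sigma>"

definition pII_sigma :: "real \<Rightarrow> real \<Rightarrow> real" where
  "pII_sigma s \<tau> = 2 powr (2/3) * (2 * s - \<tau>^2)"

definition mat4 :: "complex list list \<Rightarrow> complex ^ 4 ^ 4" where
  "mat4 xss = vector (map vector xss)"

definition diag4 :: "complex \<Rightarrow> complex \<Rightarrow> complex \<Rightarrow> complex \<Rightarrow> complex ^ 4 ^ 4" where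
  "diag4 a b c d = mat4 [[a, 0, 0, 0], [0, b, 0, 0], [0, 0, c, 0], [0, 0, 0, d]]"

lemma vector_4 [simp]:
  "(vector [x, y, z, w] :: 'a::zero ^ 4) $ 1 = x"
  "(vector [x, y, z, w] :: 'a::zero ^ 4) $ 2 = y"
  "(vector [x, y, z, w] :: 'a::zero ^ 4) $ 3 = z"
  "(vector [x, y, z, w] :: 'a::zero ^ 4) $ 4 = w"
  by (simp_all add: vector_def)

context
  fixes \<nu> :: real and q :: "real \<Rightarrow> real" and s \<tau> :: real
begin

definition tac_c :: real where
  "tac_c = - (2 powr (-1/3)) * pII_u \<nu> q (pII_sigma s \<tau>) + s^2"

definition tac_d :: real where
  "tac_d = 2 powr (-1/3) * q (pII_sigma s \<tau>)"

definition tac_G :: real where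
  "tac_G = - (tac_c^2) + tac_d^2 + s"

definition tac_H :: real where
  "tac_H = - (2 powr (1/3)) *
       (deriv q (pII_sigma s \<tau>) + q (pII_sigma s \<tau>) * pII_u \<nu> q (pII_sigma s \<tau>))
     + 2 powr (2/3) * s^2 * q (pII_sigma s \<tau>)"

definition tac_U :: "complex \<Rightarrow> complex ^ 4 ^ 4" where
  "tac_U z =
    (let c = complex_of_real tac_c; d = complex_of_real tac_d;
         G = complex_of_real tac_G; H = complex_of_real tac_H;
         n = complex_of_real \<nu>; t = complex_of_real \<tau>; s = complex_of_real s
     in mat4
      [[ - c + t,               d + n / z,             \<i>,            0          ],
       [ - d + n / z,           c - t,                 0,            \<i>          ],
       [ - \<i> * (- z + G + s),   - \<i> * H,               c + t,        d - n / z  ],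
       [ - \<i> * H,               - \<i> * (z + G + s),     - d - n / z,  - c - t    ]])"

end

text \<open>The branch of \<open>(-z)\<^sup>p\<close> that is principal in the upper half-plane, continued analytically to the
  plane cut along the negative real axis.\<close>

definition neg_powr :: "complex \<Rightarrow> real \<Rightarrow> complex" where
  "neg_powr z p = exp (- \<i> * of_real p * of_real pi) * z powr (of_real p)"

definition tac_theta1 :: "real \<Rightarrow> complex \<Rightarrow> complex" where
  "tac_theta1 s z = 2/3 * neg_powr z (3/2) + 2 * of_real s * neg_powr z (1/2)"

definition tac_theta2 :: "real \<Rightarrow> complex \<Rightarrow> complex" where
  "tac_theta2 s z = 2/3 * z powr (3/2) + 2 * of_real s * z powr (1/2)"

definition tac_A :: "complex ^ 4 ^ 4" where
  "tac_A = mat (1 / of_real (sqrt 2)) ** mat4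
      [[1, 0, - \<i>, 0],
       [0, 1, 0, \<i>],
       [- \<i>, 0, 1, 0],
       [0, \<i>, 0, 1]]"

definition tac_model :: "real \<Rightarrow> real \<Rightarrow> complex \<Rightarrow> complex ^ 4 ^ 4" where
  "tac_model s \<tau> z =
     diag4 (neg_powr z (-1/4)) (z powr (-1/4)) (neg_powr z (1/4)) (z powr (1/4)) ** tac_A **
     diag4 (exp (- tac_theta1 s z + of_real \<tau> * z)) (exp (- tac_theta2 s z - of_real \<tau> * z))
           (exp (tac_theta1 s z + of_real \<tau> * z)) (exp (tac_theta2 s z - of_real \<tau> * z))"

definition tac_sector :: "complex set" where
  "tac_sector = {z. - pi / 12 < Arg z \<and> Arg z < 7 * pi / 12}"

text \<open>
  \<open>is_tac_M \<nu> q s \<tau> M\<close> says that \<open>M\<close>, as a function of \<open>z\<close> on the cut plane, is \<open>M\<^sub>\<nu>(z; s, \<tau>)\<close>; the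
  argument \<open>q\<close> is meant to be \<open>q\<^sub>\<nu>\<close>. The error term is \<open>O(z\<^sup>-\<^sup>2)\<close> entrywise, with constants uniform
  over the sector.
\<close>

definition is_tac_M ::
    "real \<Rightarrow> (real \<Rightarrow> real) \<Rightarrow> real \<Rightarrow> real \<Rightarrow> (complex \<Rightarrow> complex ^ 4 ^ 4) \<Rightarrow> bool" where
  "is_tac_M \<nu> q s \<tau> M \<longleftrightarrow>
     (\<forall>z. z \<notin> \<real>\<^sub>\<le>\<^sub>0 \<longrightarrow> (\<forall>i j. ((\<lambda>w. M w $ i $ j) has_field_derivative
        (tac_U \<nu> q s \<tau> z ** M z) $ i $ j) (at z))) \<and>
     (\<exists>(M1 :: complex ^ 4 ^ 4) (E :: complex \<Rightarrow> complex ^ 4 ^ 4).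
        (\<forall>i j. (\<lambda>z. E z $ i $ j) \<in> O[inf at_infinity (principal tac_sector)](\<lambda>z. 1 / z^2)) \<and>
        (\<forall>\<^sub>F z in inf at_infinity (principal tac_sector).
           M z = (mat 1 + mat (1 / z) ** M1 + E z) ** tac_model s \<tau> z))"

definition tac_beta :: "real \<Rightarrow> (real \<Rightarrow> real) \<Rightarrow> real \<Rightarrow> real \<Rightarrow> real" where
  "tac_beta \<nu> q s \<tau> =
     s^2 + \<tau> - 2 powr (-1/3) * (q (pII_sigma s \<tau>) + pII_u \<nu> q (pII_sigma s \<tau>))"

definition tac_delta :: "real \<Rightarrow> (real \<Rightarrow> real) \<Rightarrow> real \<Rightarrow> real \<Rightarrow> real" where
  "tac_delta \<nu> q s \<tau> =
     s^2 - \<tau> - 2 powr (-1/3) * (q (pII_sigma s \<tau>) + pII_u \<nu> q (pII_sigma s \<tau>))"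

definition tac_gamma :: "real \<Rightarrow> (real \<Rightarrow> real) \<Rightarrow> real \<Rightarrow> real \<Rightarrow> real" where
  "tac_gamma \<nu> q s \<tau> =
     (let \<sigma> = pII_sigma s \<tau>; u = pII_u \<nu> q \<sigma>
      in 2 powr (-2/3) * ((q \<sigma>)^2 - u^2) + 2 powr (2/3) * s^2 * (q \<sigma> + u)
         - 2 powr (1/3) * (q \<sigma> * u + deriv q \<sigma>) + 2 * s - s^4)"

definition tac_R :: "real \<Rightarrow> (real \<Rightarrow> real) \<Rightarrow> real \<Rightarrow> real \<Rightarrow> complex ^ 4 ^ 4" where
  "tac_R \<nu> q s \<tau> =
    (let b = complex_of_real (tac_beta \<nu> q s \<tau>); g = complex_of_real (tac_gamma \<nu> q s \<tau>);
         d = complex_of_real (tac_delta \<nu> q s \<tau>)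
     in mat4
      [[b, b, - \<i>, \<i>],
       [- b, - b, \<i>, - \<i>],
       [\<i> * g, \<i> * g, - d, d],
       [\<i> * g, \<i> * g, - d, d]])"

definition tac_Sigma :: "complex ^ 4 ^ 4" where
  "tac_Sigma = diag4 1 (- 1) 1 (- 1)"

end

theory Submission
  imports Defs "HOL-Real_Asymp.Real_Asymp"
begin

text \<open>
  Put \<open>a = 2\<nu> + 1\<close>, \<open>F = 2q\<^sup>2 - 2q' + \<sigma>\<close> and \<open>G = 2q\<^sub>1\<^sup>2 + 2q\<^sub>1' + \<sigma>\<close>, where \<open>q\<close> and \<open>q\<^sub>1\<close> are the
  Hastings--McLeod solutions for \<open>\<nu>\<close> and \<open>\<nu> + 1\<close>. Then \<open>F' = a - 2qF\<close> and \<open>G' = 2q\<^sub>1G - a\<close>; these linear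
  equations and the asymptotics of \<open>q\<close>, \<open>q\<^sub>1\<close> give \<open>F, G > 0\<close> and \<open>F/G \<rightarrow> 1\<close> at both ends. Both \<open>ln F\<close> and
  \<open>ln G\<close> solve \<open>\<phi>'' + \<phi>'\<^sup>2/2 = exp \<phi> - \<sigma> - (a\<^sup>2/2) exp (-2\<phi>)\<close>, whose right-hand side increases with
  \<open>\<phi>\<close>, so the maximum principle forces \<open>F = G\<close>. This is the Baecklund transformation \<open>q + q\<^sub>1 = a/F\<close>.

  By the resulting relations between the coefficients, the right-hand side of the claimed identity
  solves the linear system for \<open>\<nu> + 1\<close>, and it has the required expansion because \<open>\<Sigma>\<close> commutes with the
  model. Two solutions with the same expansion differ by a constant matrix \<open>C\<close> on the right, and
  conjugating \<open>C\<close> by \<open>exp \<lambda>\<close>, where \<open>\<lambda>\<close> is the diagonal matrix of exponents, yields a function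
  tending to \<open>I\<close>. In the sector every difference \<open>Re (\<lambda>\<^sub>i - \<lambda>\<^sub>j)\<close>, \<open>i \<noteq> j\<close>, tends to \<open>+\<infinity>\<close> on some ray, so \<open>C = I\<close>.
\<close>

section \<open>Asymptotics of scalar linear equations and a maximum principle\<close>

text \<open>A nondecreasing function that is positive once stays above that value. Smallness is
  asked only frequently because the bounds on \<open>deriv q\<close> come from the mean value
  theorem, at some arbitrarily large points.\<close>

lemma frequently_small_nondecreasing_nonpos:
  fixes h h' :: "real \<Rightarrow> real"
  assumes deriv: "\<forall>\<^sub>F x in at_top. (h has_real_derivative h' x) (at x) \<and> 0 \<le> h' x"
    and small: "\<And>e. e > 0 \<Longrightarrow> \<exists>\<^sub>F x in at_top. h x < e"
  shows "\<forall>\<^sub>F x in at_top. h x \<le> 0"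
proof -
  obtain X where X: "\<And>x. x \<ge> X \<Longrightarrow> (h has_real_derivative h' x) (at x) \<and> 0 \<le> h' x"
    using deriv unfolding eventually_at_top_linorder by blast
  have "h x \<le> 0" if "x \<ge> X" for x
  proof (rule ccontr)
    assume "\<not> h x \<le> 0"
    then have "\<exists>\<^sub>F y in at_top. h y < h x"
      using small by simp
    then have "\<exists>\<^sub>F y in at_top. h y < h x \<and> x \<le> y"
      using eventually_ge_at_top by (rule frequently_eventually_frequently)
    then obtain y where y: "x \<le> y" "h y < h x"
      using frequently_ex by blast
    have "h x \<le> h y"
      by (rule DERIV_nonneg_imp_nondecreasing[OF y(1)]) (use X that order_trans in blast)
    with y show False by simp
  qed
  then show ?thesis
    unfolding eventually_at_top_linorder by blast
qed

text \<open>The equation relaxes toward \<open>1 / c\<close>. Comparison with a constant coefficient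
  \<open>m\<close> close to 1, on either side, bounds \<open>\<rho>\<close> by \<open>1 / m\<close>
  up to a multiple of \<open>exp (- (m * K x))\<close>.\<close>

lemma stable_linear_ode_tendsto_1:
  fixes \<rho> k K c :: "real \<Rightarrow> real"
  assumes \<rho>: "\<forall>\<^sub>F x in at_top. (\<rho> has_real_derivative k x * (1 - c x * \<rho> x)) (at x)"
    and \<rho>0: "\<forall>\<^sub>F x in at_top. \<rho> x > 0"
    and K: "\<forall>\<^sub>F x in at_top. (K has_real_derivative k x) (at x)"
    and k0: "\<forall>\<^sub>F x in at_top. k x \<ge> 0"
    and Ktop: "filterlim K at_top at_top"
    and c: "(c \<longlongrightarrow> 1) at_top"
  shows "(\<rho> \<longlongrightarrow> 1) at_top"
proof (rule order_tendstoI)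
  \<comment> \<open>For \<open>c = m\<close> this is a first integral. In general its derivative
    has, up to nonnegative factors, the sign of \<open>m - c x\<close>.\<close>
  define h where "h m x = (\<rho> x - 1 / m) * exp (m * K x)" for m x
  have h: "\<forall>\<^sub>F x in at_top. (h m has_real_derivative k x * exp (m * K x) * (m - c x) * \<rho> x) (at x)"
    if "m > 0" for m
    using \<rho> K
  proof eventually_elim
    case (elim x)
    show ?case
      unfolding h_def using that
      by (auto intro!: derivative_eq_intros elim simp: field_simps)
  qed
  have bound: "((\<lambda>x. 1 / m + C * exp (- (m * K x))) \<longlongrightarrow> 1 / m) at_top" if "m > 0" for C m
  proof -
    have "filterlim (\<lambda>x. m * K x) at_top at_top"
      using Ktop that by (simp add: filterlim_tendsto_pos_mult_at_top[OF tendsto_const])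
    then have "((\<lambda>x. exp (- (m * K x))) \<longlongrightarrow> 0) at_top"
      by (intro filterlim_compose[OF exp_at_bot]) (simp add: filterlim_uminus_at_top)
    from tendsto_add[OF tendsto_const tendsto_mult_left[OF this]] show ?thesis
      by simp
  qed
  fix b :: real
  {
    assume "1 < b"
    \<comment> \<open>\<open>m < 1\<close> makes \<open>h m\<close> eventually nonincreasing, and
      \<open>1 / b < m\<close> puts the resulting limit \<open>1 / m\<close> below
      \<open>b\<close>.\<close>
    then obtain m where m: "1 / b < m" "m < 1"
      using dense[of "1 / b" 1] by auto
    then have m0: "m > 0"
      using \<open>1 < b\<close> by (intro less_trans[OF _ m(1)]) simp
    have "\<forall>\<^sub>F x in at_top. (h m has_real_derivative k x * exp (m * K x) * (m - c x) * \<rho> x) (at x)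
        \<and> k x * exp (m * K x) * (m - c x) * \<rho> x \<le> 0"
      using h[OF m0] k0 \<rho>0 order_tendstoD(1)[OF c \<open>m < 1\<close>]
    proof eventually_elim
      case (elim x)
      then have "0 \<le> k x * exp (m * K x) * (c x - m) * \<rho> x"
        by simp
      with elim show ?case
        by (simp add: algebra_simps)
    qed
    then obtain X where X: "\<And>x. x \<ge> X \<Longrightarrow>
        (h m has_real_derivative k x * exp (m * K x) * (m - c x) * \<rho> x) (at x)
        \<and> k x * exp (m * K x) * (m - c x) * \<rho> x \<le> 0"
      unfolding eventually_at_top_linorder by blast
    have "h m x \<le> h m X" if "X \<le> x" for x
      by (rule DERIV_nonpos_imp_nonincreasing[OF that]) (use X in force)
    then have "\<forall>\<^sub>F x in at_top. \<rho> x \<le> 1 / m + h m X * exp (- (m * K x))"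
      unfolding eventually_at_top_linorder h_def
      by (intro exI[of _ X]) (auto simp: exp_minus field_simps)
    moreover have "\<forall>\<^sub>F x in at_top. 1 / m + h m X * exp (- (m * K x)) < b"
      by (rule order_tendstoD(2)[OF bound[OF m0]]) (use m m0 \<open>1 < b\<close> in \<open>simp add: field_simps\<close>)
    ultimately show "\<forall>\<^sub>F x in at_top. \<rho> x < b"
      by eventually_elim simp
  next
    assume "b < 1"
    show "\<forall>\<^sub>F x in at_top. b < \<rho> x"
    proof (cases "b \<le> 0")
      case True
      with \<rho>0 show ?thesis by (auto elim: eventually_mono)
    next
      case False
      then obtain m where m: "1 < m" "m < 1 / b"
        using dense[of 1 "1 / b"] \<open>b < 1\<close> by auto
      then have m0: "m > 0" by simp
      have "\<forall>\<^sub>F x in at_top. (h m has_real_derivative k x * exp (m * K x) * (m - c x) * \<rho> x) (at x)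
          \<and> 0 \<le> k x * exp (m * K x) * (m - c x) * \<rho> x"
        using h[OF m0] k0 \<rho>0 order_tendstoD(2)[OF c \<open>1 < m\<close>]
        by eventually_elim auto
      then obtain X where X: "\<And>x. x \<ge> X \<Longrightarrow>
          (h m has_real_derivative k x * exp (m * K x) * (m - c x) * \<rho> x) (at x)
          \<and> 0 \<le> k x * exp (m * K x) * (m - c x) * \<rho> x"
        unfolding eventually_at_top_linorder by blast
      have "h m X \<le> h m x" if "X \<le> x" for x
        by (rule DERIV_nonneg_imp_nondecreasing[OF that]) (use X in force)
      then have "\<forall>\<^sub>F x in at_top. \<rho> x \<ge> 1 / m + h m X * exp (- (m * K x))"
        unfolding eventually_at_top_linorder h_def
        by (intro exI[of _ X]) (auto simp: exp_minus field_simps)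
      moreover have "\<forall>\<^sub>F x in at_top. 1 / m + h m X * exp (- (m * K x)) > b"
        by (rule order_tendstoD(1)[OF bound[OF m0]]) (use m m0 False in \<open>simp add: field_simps\<close>)
      ultimately show ?thesis
        by eventually_elim simp
    qed
  }
qed

text \<open>The equation repels from \<open>1 / c\<close>: solutions leave it at a rate close to
  \<open>exp K\<close>. The bound by \<open>B\<close> at arbitrarily large points excludes leaving
  upward, and positivity excludes leaving downward.\<close>

lemma unstable_linear_ode_tendsto_1:
  fixes \<rho> k K B c :: "real \<Rightarrow> real"
  assumes \<rho>: "\<forall>\<^sub>F x in at_top. (\<rho> has_real_derivative k x * (c x * \<rho> x - 1)) (at x)"
    and \<rho>0: "\<forall>\<^sub>F x in at_top. \<rho> x > 0"
    and K: "\<forall>\<^sub>F x in at_top. (K has_real_derivative k x) (at x)"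
    and k0: "\<forall>\<^sub>F x in at_top. k x \<ge> 0"
    and Ktop: "filterlim K at_top at_top"
    and c: "(c \<longlongrightarrow> 1) at_top"
    and \<rho>B: "\<exists>\<^sub>F x in at_top. \<rho> x \<le> B x"
    and B: "((\<lambda>x. B x * exp (- K x / 2)) \<longlongrightarrow> 0) at_top"
  shows "(\<rho> \<longlongrightarrow> 1) at_top"
proof (rule order_tendstoI)
  define h where "h m x = (\<rho> x - 1 / m) * exp (- m * K x)" for m x
  have h: "\<forall>\<^sub>F x in at_top. (h m has_real_derivative k x * exp (- m * K x) * (c x - m) * \<rho> x) (at x)"
    if "m > 0" for m
    using \<rho> K
  proof eventually_elim
    case (elim x)
    show ?case
      unfolding h_def using that
      by (auto intro!: derivative_eq_intros elim simp: field_simps)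
  qed
  have K0: "\<forall>\<^sub>F x in at_top. K x \<ge> 0"
    using Ktop unfolding filterlim_at_top by blast
  fix b :: real
  {
    assume "1 < b"
    \<comment> \<open>\<open>1 / b < m\<close> gives \<open>1 / m < b\<close>, and
      \<open>1 / 2 < m\<close> gives \<open>exp (- m * K x) \<le> exp (- K x / 2)\<close>, the rate
      that occurs in assumption \<open>B\<close>.\<close>
    then obtain m where m: "max (1 / b) (1 / 2) < m" "m < 1"
      using dense[of "max (1 / b) (1 / 2)" 1] by auto
    have m0: "m > 0"
      using m by simp
    have "\<forall>\<^sub>F x in at_top. (h m has_real_derivative k x * exp (- m * K x) * (c x - m) * \<rho> x) (at x)
        \<and> 0 \<le> k x * exp (- m * K x) * (c x - m) * \<rho> x"
      using h[OF m0] k0 \<rho>0 order_tendstoD(1)[OF c \<open>m < 1\<close>]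
      by eventually_elim auto
    moreover have "\<exists>\<^sub>F x in at_top. h m x < e" if "e > 0" for e
    proof -
      have "\<forall>\<^sub>F x in at_top. B x * exp (- K x / 2) < e \<and> \<rho> x > 0 \<and> K x \<ge> 0"
        using \<rho>0 K0 order_tendstoD(2)[OF B that] by eventually_elim simp
      from frequently_eventually_frequently[OF \<rho>B this] show ?thesis
      proof (rule frequently_elim1)
        fix x
        assume x: "\<rho> x \<le> B x \<and> B x * exp (- K x / 2) < e \<and> 0 < \<rho> x \<and> 0 \<le> K x"
        have "K x * (1 / 2) \<le> K x * m"
          using x m by (intro mult_left_mono) auto
        then have "exp (- m * K x) \<le> exp (- K x / 2)"
          by (simp add: mult.commute)
        then have "\<rho> x * exp (- m * K x) \<le> B x * exp (- K x / 2)"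
          using x by (intro mult_mono) auto
        moreover have "h m x \<le> \<rho> x * exp (- m * K x)"
          unfolding h_def using m0 by (intro mult_right_mono) auto
        ultimately show "h m x < e"
          using x by linarith
      qed
    qed
    ultimately have "\<forall>\<^sub>F x in at_top. h m x \<le> 0"
      by (rule frequently_small_nondecreasing_nonpos)
    then show "\<forall>\<^sub>F x in at_top. \<rho> x < b"
    proof eventually_elim
      case (elim x)
      then have "\<rho> x \<le> 1 / m"
        by (simp add: h_def mult_le_0_iff)
      also have "1 / m < b"
        using m m0 \<open>1 < b\<close> by (simp add: field_simps)
      finally show ?case .
    qed
  next
    assume "b < 1"
    show "\<forall>\<^sub>F x in at_top. b < \<rho> x"
    proof (cases "b \<le> 0")
      case True
      with \<rho>0 show ?thesis by (auto elim: eventually_mono)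
    next
      case False
      then obtain m where m: "1 < m" "m < 1 / b"
        using dense[of 1 "1 / b"] \<open>b < 1\<close> by auto
      then have m0: "m > 0" by simp
      have "\<forall>\<^sub>F x in at_top.
          ((\<lambda>x. - h m x) has_real_derivative - (k x * exp (- m * K x) * (c x - m) * \<rho> x)) (at x)
          \<and> 0 \<le> - (k x * exp (- m * K x) * (c x - m) * \<rho> x)"
        using h[OF m0] k0 \<rho>0 order_tendstoD(2)[OF c \<open>1 < m\<close>]
      proof eventually_elim
        case (elim x)
        then have "0 \<le> k x * exp (- m * K x) * (m - c x) * \<rho> x"
          by simp
        with DERIV_minus[OF elim(1)] show ?case
          by (simp add: algebra_simps)
      qed
      \<comment> \<open>Since \<open>\<rho> x > 0\<close>, the quantity \<open>- h m x\<close> is at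
        most \<open>1 / m * exp (- (m * K x))\<close>, which tends to 0.\<close>
      moreover have "\<exists>\<^sub>F x in at_top. - h m x < e" if "e > 0" for e
      proof (rule eventually_frequently)
        have "filterlim (\<lambda>x. m * K x) at_top at_top"
          using Ktop m0 by (simp add: filterlim_tendsto_pos_mult_at_top[OF tendsto_const])
        then have "((\<lambda>x. exp (- (m * K x))) \<longlongrightarrow> 0) at_top"
          by (intro filterlim_compose[OF exp_at_bot]) (simp add: filterlim_uminus_at_top)
        from order_tendstoD(2)[OF this, of "m * e"]
        have "\<forall>\<^sub>F x in at_top. exp (- (m * K x)) < m * e"
          using that m0 by simp
        with \<rho>0 show "\<forall>\<^sub>F x in at_top. - h m x < e"
        proof eventually_elim
          case (elim x)
          have "- h m x \<le> 1 / m * exp (- (m * K x))"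
            using elim by (simp add: h_def algebra_simps)
          also have "\<dots> < e"
            using elim m0 by (simp add: field_simps)
          finally show ?case .
        qed
      qed simp
      ultimately have "\<forall>\<^sub>F x in at_top. - h m x \<le> 0"
        by (rule frequently_small_nondecreasing_nonpos)
      then show ?thesis
      proof eventually_elim
        case (elim x)
        have "b < 1 / m"
          using m m0 False by (simp add: field_simps)
        also have "1 / m \<le> \<rho> x"
          using elim by (simp add: h_def zero_le_mult_iff)
        finally show ?case .
      qed
    qed
  }
qed

text \<open>At a positive maximum \<open>f'\<close> vanishes and, by \<open>crit\<close>, increases,
  so \<open>f\<close> grows to the right of the maximum, a contradiction. Decay at both ends makes
  the maximum exist.\<close>

lemma max_principle_vanishing_at_infinity:
  fixes f f' f'' :: "real \<Rightarrow> real"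
  assumes f: "\<And>x. (f has_real_derivative f' x) (at x)"
    and f': "\<And>x. (f' has_real_derivative f'' x) (at x)"
    and top: "(f \<longlongrightarrow> 0) at_top" and bot: "(f \<longlongrightarrow> 0) at_bot"
    and crit: "\<And>x. f x > 0 \<Longrightarrow> f' x = 0 \<Longrightarrow> f'' x > 0"
  shows "f x \<le> 0"
proof (rule ccontr)
  assume "\<not> f x \<le> 0"
  then have fx: "f x > 0" by simp
  obtain u where u: "\<And>y. y \<ge> u \<Longrightarrow> f y < f x"
    using order_tendstoD(2)[OF top fx] unfolding eventually_at_top_linorder by blast
  obtain l where l: "\<And>y. y \<le> l \<Longrightarrow> f y < f x"
    using order_tendstoD(2)[OF bot fx] unfolding eventually_at_bot_linorder by blast
  have x: "l < x" "x < u"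
    using u[of x] l[of x] by (auto simp: not_le[symmetric])
  have "continuous_on {l..u} f"
    by (rule DERIV_continuous_on[OF has_field_derivative_at_within[OF f]])
  then obtain m where m: "m \<in> {l..u}" "\<And>y. y \<in> {l..u} \<Longrightarrow> f y \<le> f m"
    using continuous_attains_sup[of "{l..u}" f] x by fastforce
  \<comment> \<open>Outside \<open>{l..u}\<close> the values stay below \<open>f x\<close>, so the
    maximum over the interval is global.\<close>
  have max: "f y \<le> f m" for y
    using m(2)[of y] m(2)[of x] u[of y] l[of y] x by fastforce
  have "f' m = 0"
    by (rule DERIV_local_max[OF f zero_less_one]) (use max in auto)
  moreover have "f m > 0"
    using max[of x] fx by simp
  ultimately obtain d where d: "d > 0" "\<And>h. 0 < h \<Longrightarrow> h < d \<Longrightarrow> 0 < f' (m + h)"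
    using DERIV_pos_inc_right[OF f', of m] crit[of m] by auto
  obtain y where y: "m < y" "y < m + d / 2" "f (m + d / 2) - f m = (m + d / 2 - m) * f' y"
    using MVT2[of m "m + d / 2" f f'] f d(1) by auto
  have "0 < f' y"
    using d(2)[of "y - m"] y by simp
  then have "0 < (m + d / 2 - m) * f' y"
    using d(1) by simp
  then have "f m < f (m + d / 2)"
    using y(3) by linarith
  with max[of "m + d / 2"] show False by simp
qed

text \<open>Asymptotics of \<open>p\<close> cannot be differentiated, but the mean value theorem on
  intervals of length 1 provides points with a controlled derivative. The shift \<open>x + 1\<close>
  covers both endpoints of the interval.\<close>

lemma frequently_deriv_bound:
  fixes p p' b :: "real \<Rightarrow> real"
  assumes p: "\<And>x. (p has_real_derivative p' x) (at x)"
    and b: "\<forall>\<^sub>F x in at_top. \<bar>p x\<bar> \<le> b x" and "mono b"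
  shows "\<exists>\<^sub>F x in at_top. \<bar>p' x\<bar> \<le> 2 * b (x + 1)"
proof -
  obtain X where X: "\<And>x. x \<ge> X \<Longrightarrow> \<bar>p x\<bar> \<le> b x"
    using b unfolding eventually_at_top_linorder by blast
  have "\<exists>y\<ge>x. \<bar>p' y\<bar> \<le> 2 * b (y + 1)" for x
  proof -
    define z where "z = max x X"
    obtain y where y: "z < y" "y < z + 1" "p (z + 1) - p z = (z + 1 - z) * p' y"
      using MVT2[of z "z + 1" p p'] p by auto
    have "\<bar>p (z + 1)\<bar> \<le> b (z + 1)" "\<bar>p z\<bar> \<le> b z"
      using X[of z] X[of "z + 1"] by (auto simp: z_def)
    moreover have "b (z + 1) \<le> b (y + 1)" "b z \<le> b (y + 1)"
      using y by (auto intro!: monoD[OF \<open>mono b\<close>])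
    ultimately have "\<bar>p' y\<bar> \<le> 2 * b (y + 1)"
      using y(3) by simp
    then show ?thesis
      using y(1) by (intro exI[of _ y]) (auto simp: z_def)
  qed
  then show ?thesis
    unfolding frequently_def eventually_at_top_linorder by (metis linorder_not_le)
qed

lemma antiderivative_ex:
  fixes f :: "real \<Rightarrow> real"
  assumes "\<And>x. isCont f x"
  obtains P where "\<And>x. (P has_real_derivative f x) (at x)"
  using einterval_antiderivative[of "-\<infinity>" \<infinity> f] assms
  by (auto simp: has_real_derivative_iff_has_vector_derivative)

section \<open>Hastings--McLeod solutions\<close>

text \<open>Two integrations by parts; the boundary terms are collected in \<open>B\<close>.\<close>

lemma airy_Ai_bound:
  assumes x: "x \<ge> 1"
  shows "\<bar>airy_Ai x\<bar> \<le> 7 / x^2"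
proof -
  define \<phi> :: "real \<Rightarrow> real" where "\<phi> t = t ^ 3 / 3 + x * t" for t
  define p where "p t = t^2 + x" for t
  define B where "B t = sin (\<phi> t) / p t - cos (\<phi> t) * (2 * t) / p t ^ 3" for t
  define r where "r t = cos (\<phi> t) * (2 / p t ^ 3 - 12 * t^2 / p t ^ 4)" for t
  define J where "J t = integral {0..t} (\<lambda>t. cos (\<phi> t))" for t
  have p_pos: "p t > 0" for t
    using x by (simp add: p_def add_nonneg_pos)
  have \<phi>: "(\<phi> has_real_derivative p t) (at t)" for t
    unfolding \<phi>_def p_def
    by (auto intro!: derivative_eq_intros simp: power2_eq_square algebra_simps)
  have p: "(p has_real_derivative 2 * t) (at t)" for t
    unfolding p_def by (auto intro!: derivative_eq_intros)
  have B: "(B has_real_derivative cos (\<phi> t) - r t) (at t)" for t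
  proof -
    have "(B has_real_derivative
        (cos (\<phi> t) * p t * p t - sin (\<phi> t) * (2 * t)) / (p t * p t)
        - ((- sin (\<phi> t) * p t * (2 * t) + cos (\<phi> t) * 2) * p t ^ 3
           - cos (\<phi> t) * (2 * t) * (3 * p t ^ 2 * (2 * t))) / (p t ^ 3 * p t ^ 3)) (at t)"
      unfolding B_def using p_pos[of t]
      by (auto intro!: derivative_eq_intros p \<phi>)
    moreover have "(C * P * P - S * (2 * t)) / (P * P)
        - ((- S * P * (2 * t) + C * 2) * P ^ 3 - C * (2 * t) * (3 * P ^ 2 * (2 * t))) / (P ^ 3 * P ^ 3)
        = C - C * (2 / P ^ 3 - 12 * t^2 / P ^ 4)" if "P > 0" for C S P :: real
      using that by (simp add: divide_simps) (simp add: algebra_simps power_numeral_reduce)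
    ultimately show ?thesis
      using p_pos[of t] unfolding r_def by simp
  qed
  \<comment> \<open>Two of the three factors of \<open>p t ^ 3\<close> dominate \<open>x^2\<close>,
    and the third dominates \<open>1 + t^2\<close> because \<open>x \<ge> 1\<close>. The integral of
    \<open>inverse (1 + t^2)\<close> is at most \<open>pi / 2\<close>, which yields
    \<open>7 * pi / x^2\<close> below.\<close>
  have r: "\<bar>r t\<bar> \<le> 14 / x^2 * inverse (1 + t^2)" for t
  proof -
    have "x^2 * (1 + t^2) \<le> p t ^ 2 * p t"
      using x by (intro mult_mono power_mono) (auto simp: p_def)
    then have le: "14 / p t ^ 3 \<le> 14 / x^2 * inverse (1 + t^2)"
      using x p_pos[of t] by (simp add: divide_simps power3_eq_cube power2_eq_square add_pos_nonneg)
    have "12 * t^2 / p t ^ 4 \<le> 12 * p t / p t ^ 4"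
      using x by (intro divide_right_mono) (auto simp: p_def)
    also have "\<dots> = 12 / p t ^ 3"
      using p_pos[of t] by (simp add: field_simps power_numeral_reduce)
    finally have "12 * t^2 / p t ^ 4 \<le> 12 / p t ^ 3" .
    moreover have "0 \<le> 12 * t^2 / p t ^ 4" "0 \<le> 2 / p t ^ 3" "14 / p t ^ 3 = 2 / p t ^ 3 + 12 / p t ^ 3"
      using p_pos[of t] by auto
    ultimately have "\<bar>2 / p t ^ 3 - 12 * t^2 / p t ^ 4\<bar> \<le> 14 / p t ^ 3"
      by linarith
    then have "\<bar>r t\<bar> \<le> 1 * (14 / p t ^ 3)"
      unfolding r_def abs_mult by (intro mult_mono) auto
    with le show ?thesis by simp
  qed
  have cont: "continuous_on S (\<lambda>t. cos (\<phi> t))" for S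
    unfolding \<phi>_def by (intro continuous_intros) auto
  have J: "\<bar>J b - B b\<bar> \<le> 7 * pi / x^2" if b: "b \<ge> 0" for b
  proof -
    have "((\<lambda>t. cos (\<phi> t) - r t) has_integral B b - B 0) {0..b}"
      by (rule fundamental_theorem_of_calculus[OF b])
         (use B in \<open>auto simp: has_real_derivative_iff_has_vector_derivative[symmetric]
            intro: has_field_derivative_at_within\<close>)
    moreover have "((\<lambda>t. cos (\<phi> t)) has_integral J b) {0..b}"
      unfolding J_def using cont by (intro integrable_integral integrable_continuous_real)
    ultimately have "((\<lambda>t. cos (\<phi> t) - (cos (\<phi> t) - r t)) has_integral J b - (B b - B 0)) {0..b}"
      by (rule has_integral_diff[rotated])
    then have rint: "(r has_integral J b - B b) {0..b}"
      by (simp add: B_def \<phi>_def)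
    have arctan: "((\<lambda>t. 14 / x^2 * arctan t) has_real_derivative 14 / x^2 * inverse (1 + t^2)) (at t)" for t
      by (rule DERIV_cmult[OF DERIV_arctan])
    have aint: "((\<lambda>t. 14 / x^2 * inverse (1 + t^2)) has_integral
        14 / x^2 * arctan b - 14 / x^2 * arctan 0) {0..b}"
      by (rule fundamental_theorem_of_calculus[OF b])
         (use arctan in \<open>simp only: has_real_derivative_iff_has_vector_derivative[symmetric]
            has_field_derivative_at_within\<close>)
    have "norm (integral {0..b} r) \<le> integral {0..b} (\<lambda>t. 14 / x^2 * inverse (1 + t^2))"
      using r
      by (intro integral_norm_bound_integral has_integral_integrable[OF rint]
          has_integral_integrable[OF aint]) auto
    then have "\<bar>J b - B b\<bar> \<le> 14 / x^2 * arctan b"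
      unfolding integral_unique[OF rint] integral_unique[OF aint] by simp
    also have "\<dots> \<le> 14 / x^2 * (pi / 2)"
      using arctan_ubound[of b] by (intro mult_left_mono) auto
    finally show ?thesis by simp
  qed
  have Blim: "(B \<longlongrightarrow> 0) at_top"
  proof (rule Lim_null_comparison)
    show "\<forall>\<^sub>F t in at_top. norm (B t) \<le> 1 / (t^2 + x) + 2 * t / (t^2 + x)^3"
      using eventually_ge_at_top[of 0]
    proof eventually_elim
      case (elim t)
      have "\<bar>sin (\<phi> t) / p t\<bar> \<le> 1 / p t" "\<bar>cos (\<phi> t) * (2 * t) / p t ^ 3\<bar> \<le> 2 * t / p t ^ 3"
        using p_pos[of t] elim
        by (auto simp: abs_mult intro!: divide_right_mono mult_left_le_one_le)
      then have "\<bar>B t\<bar> \<le> 1 / p t + 2 * t / p t ^ 3"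
        unfolding B_def by linarith
      then show ?case
        by (simp add: p_def)
    qed
    show "((\<lambda>t. 1 / (t^2 + x) + 2 * t / (t^2 + x)^3) \<longlongrightarrow> 0) at_top"
      by real_asymp
  qed
  have "\<bar>integral {0..} (\<lambda>t. cos (\<phi> t))\<bar> \<le> 7 * pi / x^2"
  proof (cases "(\<lambda>t. cos (\<phi> t)) integrable_on {0..}")
    \<comment> \<open>A function that is not integrable has \<open>integral\<close> equal to 0,
      which satisfies the bound.\<close>
    case False
    then show ?thesis by (simp add: not_integrable_integral)
  next
    case True
    define y where "y = integral {0..} (\<lambda>t. cos (\<phi> t))"
    have y: "((\<lambda>t. cos (\<phi> t)) has_integral y) {0..}"
      unfolding y_def using True by (rule integrable_integral)
    show ?thesis unfolding y_def[symmetric]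
    proof (rule field_le_epsilon)
      fix e :: real assume "e > 0"
      then have "e / 2 > 0" by simp
      \<comment> \<open>The integral over \<open>{0..}\<close> is approximated on boxes containing a
        large ball. The box from \<open>- b\<close> to \<open>b\<close> meets \<open>{0..}\<close>
        in \<open>{0..b}\<close>, so it contributes \<open>J b\<close>.\<close>
      then obtain L where L: "L > 0" "\<And>a b. ball 0 L \<subseteq> cbox a b \<Longrightarrow>
          norm (integral (cbox a b) (\<lambda>t. if t \<in> {0..} then cos (\<phi> t) else 0) - y) < e / 2"
        using y[unfolded has_integral_alt', THEN conjunct2, rule_format, OF \<open>e / 2 > 0\<close>] by blast
      have "\<forall>\<^sub>F t in at_top. \<bar>B t\<bar> < e / 2"
        using tendstoD[OF Blim \<open>e / 2 > 0\<close>] by simp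
      from eventually_happens'[OF _ eventually_conj[OF this eventually_ge_at_top[of L]]]
      obtain b where b: "\<bar>B b\<bar> < e / 2" "L \<le> b"
        by auto
      have "{- b..b} \<inter> {0..} = {0..b}"
        using b L by auto
      then have "integral {- b..b} (\<lambda>t. if t \<in> {0..} then cos (\<phi> t) else 0) = J b"
        by (simp only: J_def integral_restrict_Int Int_commute)
      moreover have "ball 0 L \<subseteq> cbox (- b) b"
        using b by (auto simp: dist_real_def)
      ultimately have "\<bar>J b - y\<bar> < e / 2"
        using L(2)[of "- b" b] by simp
      with J[of b] b L show "\<bar>y\<bar> \<le> 7 * pi / x^2 + e"
        by linarith
    qed
  qed
  then show ?thesis
    unfolding airy_Ai_def \<phi>_def using pi_gt_zero by (simp add: abs_mult field_simps)
qed

text \<open>For \<open>\<nu> = 0\<close> the prescribed behaviour is that of \<open>airy_Ai\<close>,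
  and \<open>airy_Ai_bound\<close> gives \<open>x * airy_Ai x \<rightarrow> 0\<close>. The two cases
  thus share one limit, the one that enters the equations for \<open>F x / x\<close> and
  \<open>G x / x\<close>.\<close>

lemma hastings_mcleod_at_top:
  assumes "hastings_mcleod \<nu> q"
  shows "((\<lambda>x. x * q x) \<longlongrightarrow> \<nu>) at_top"
proof -
  have q: "q \<sim>[at_top] (\<lambda>\<sigma>. if \<nu> = 0 then airy_Ai \<sigma> else \<nu> / \<sigma>)"
    using assms unfolding hastings_mcleod_def by blast
  show ?thesis
  proof (cases "\<nu> = 0")
    case True
    have "((\<lambda>x. x * airy_Ai x) \<longlongrightarrow> 0) at_top"
    proof (rule Lim_null_comparison)
      show "\<forall>\<^sub>F x in at_top. norm (x * airy_Ai x) \<le> 7 / x"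
        using eventually_ge_at_top[of 1]
      proof eventually_elim
        case (elim x)
        have "x * \<bar>airy_Ai x\<bar> \<le> x * (7 / x^2)"
          using elim airy_Ai_bound[of x] by (intro mult_left_mono) auto
        then show ?case
          using elim by (simp add: abs_mult power2_eq_square)
      qed
      show "((\<lambda>x::real. 7 / x) \<longlongrightarrow> 0) at_top"
        by real_asymp
    qed
    moreover have "(\<lambda>x. x * q x) \<sim>[at_top] (\<lambda>x. x * airy_Ai x)"
      using q True by (intro asymp_equiv_mult) auto
    ultimately show ?thesis
      using True asymp_equiv_tendsto_transfer asymp_equiv_sym by blast
  next
    case False
    have "(\<lambda>x. x * q x) \<sim>[at_top] (\<lambda>x. x * (\<nu> / x))"
      using q False by (intro asymp_equiv_mult) auto
    moreover have "((\<lambda>x. x * (\<nu> / x)) \<longlongrightarrow> \<nu>) at_top"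
      by real_asymp
    ultimately show ?thesis
      using asymp_equiv_tendsto_transfer asymp_equiv_sym by blast
  qed
qed

text \<open>At \<open>\<sigma> = - x\<close> the prescribed \<open>sqrt (- \<sigma> / 2)\<close> is
  half of \<open>sqrt (2 * x)\<close>. The quotient is the leading part of the coefficient in the
  rescaled equations for \<open>F\<close> and \<open>G\<close> at minus infinity.\<close>

lemma hastings_mcleod_at_bot:
  assumes "hastings_mcleod \<nu> q"
  shows "((\<lambda>x. 2 * q (- x) / sqrt (2 * x)) \<longlongrightarrow> 1) at_top"
proof -
  have "q \<sim>[at_bot] (\<lambda>\<sigma>. sqrt (- \<sigma> / 2))"
    using assms unfolding hastings_mcleod_def by blast
  then have "(\<lambda>x. q (- x)) \<sim>[at_top] (\<lambda>x. sqrt (- (- x) / 2))"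
    using filterlim_uminus_at_bot_at_top by (rule asymp_equiv_compose')
  moreover have "\<forall>\<^sub>F x in at_top. q (- x) \<noteq> 0 \<or> sqrt (- (- x) / 2) \<noteq> 0"
    using eventually_gt_at_top[of 0] by eventually_elim simp
  ultimately have "((\<lambda>x. q (- x) / sqrt (- (- x) / 2)) \<longlongrightarrow> 1) at_top"
    by (rule asymp_equivD_strong)
  then have "((\<lambda>x. q (- x) / sqrt (x / 2)) \<longlongrightarrow> 1) at_top"
    by (simp only: minus_minus)
  moreover have "\<forall>\<^sub>F x in at_top. q (- x) / sqrt (x / 2) = 2 * q (- x) / sqrt (2 * x)"
    using eventually_gt_at_top[of 0]
  proof eventually_elim
    case (elim x)
    have "sqrt (2 * x) = 2 * sqrt (x / 2)"
      using elim by (intro real_sqrt_unique) (auto simp: power_mult_distrib)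
    then show ?case by simp
  qed
  ultimately show ?thesis
    by (rule Lim_transform_eventually)
qed

lemma hastings_mcleod_at_bot_bounds:
  assumes "hastings_mcleod \<nu> q"
  shows "\<forall>\<^sub>F x in at_top. 1 \<le> q (- x) \<and> q (- x) \<le> x"
proof -
  have "\<forall>\<^sub>F x in at_top. 1 / 2 < 2 * q (- x) / sqrt (2 * x)"
    by (rule order_tendstoD(1)[OF hastings_mcleod_at_bot[OF assms]]) simp
  moreover have "\<forall>\<^sub>F x in at_top. 2 * q (- x) / sqrt (2 * x) < 2"
    by (rule order_tendstoD(2)[OF hastings_mcleod_at_bot[OF assms]]) simp
  \<comment> \<open>The ratio bounds mean \<open>sqrt (2 * x) / 4 < q (- x) < sqrt (2 * x)\<close>;
    these inequalities turn them into the bounds 1 and \<open>x\<close>.\<close>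
  moreover have "\<forall>\<^sub>F x::real in at_top. 4 \<le> sqrt (2 * x)" "\<forall>\<^sub>F x::real in at_top. sqrt (2 * x) \<le> x"
    by real_asymp+
  ultimately show ?thesis
    by eventually_elim (auto simp: field_simps)
qed

section \<open>The pair \<open>q\<close>, \<open>q1\<close> and the auxiliary functions
  \<open>F\<close>, \<open>G\<close>\<close>

locale painleve_pair =
  fixes \<nu> :: real and q q1 :: "real \<Rightarrow> real"
  assumes \<nu>: "\<nu> > - 1 / 2"
    and q: "hastings_mcleod \<nu> q"
    and q1: "hastings_mcleod (\<nu> + 1) q1"
begin

definition a :: real where "a = 2 * \<nu> + 1"

definition F :: "real \<Rightarrow> real" where "F x = 2 * q x ^ 2 - 2 * deriv q x + x"

text \<open>The counterpart of \<open>F\<close> for the inverse transformation, from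
  \<open>\<nu> + 1\<close> back to \<open>\<nu>\<close>.\<close>

definition G :: "real \<Rightarrow> real" where "G x = 2 * q1 x ^ 2 + 2 * deriv q1 x + x"

text \<open>The assumption \<open>\<nu> > - 1 / 2\<close> enters the proof through this
  sign.\<close>

lemma a_pos: "a > 0"
  using \<nu> by (simp add: a_def)

lemma deriv_q: "(q has_real_derivative deriv q x) (at x)"
  and deriv2_q: "(deriv q has_real_derivative 2 * q x ^ 3 + x * q x - \<nu>) (at x)"
  and deriv_q1: "(q1 has_real_derivative deriv q1 x) (at x)"
  and deriv2_q1: "(deriv q1 has_real_derivative 2 * q1 x ^ 3 + x * q1 x - (\<nu> + 1)) (at x)"
  using q q1 unfolding hastings_mcleod_def by blast+

lemma deriv_F: "(F has_real_derivative a - 2 * q x * F x) (at x)"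
  unfolding F_def a_def
  by (auto intro!: derivative_eq_intros deriv_q deriv2_q
      simp: algebra_simps power2_eq_square power3_eq_cube)

lemma deriv_G: "(G has_real_derivative 2 * q1 x * G x - a) (at x)"
  unfolding G_def a_def
  by (auto intro!: derivative_eq_intros deriv_q1 deriv2_q1
      simp: algebra_simps power2_eq_square power3_eq_cube)

section \<open>Positivity of \<open>F\<close> and \<open>G\<close>\<close>

lemma deriv_reflect:
  assumes "\<And>x. (f has_real_derivative f' x) (at x)"
  shows "((\<lambda>x. f (- x)) has_real_derivative - f' (- x)) (at x)"
  using DERIV_chain2[OF assms DERIV_minus[OF DERIV_ident], of x] by simp

lemma frequently_abs_deriv_q_le: "\<exists>\<^sub>F x in at_top. \<bar>deriv q (- x)\<bar> \<le> 2 * (x + 1)"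
proof -
  have "\<exists>\<^sub>F x in at_top. \<bar>- deriv q (- x)\<bar> \<le> 2 * (x + 1)"
  proof (rule frequently_deriv_bound)
    show "((\<lambda>x. q (- x)) has_real_derivative - deriv q (- x)) (at x)" for x
      by (rule deriv_reflect[OF deriv_q])
    show "\<forall>\<^sub>F x in at_top. \<bar>q (- x)\<bar> \<le> x"
      using hastings_mcleod_at_bot_bounds[OF q] by eventually_elim auto
  qed (simp add: mono_def)
  then show ?thesis by simp
qed

text \<open>The constant \<open>1 / 4\<close> makes the mean value bound on \<open>deriv q1\<close>
  equal to \<open>1 / 2\<close>, hence \<open>2 * deriv q1 x \<ge> - 1\<close> in the sign argument
  for \<open>G\<close>.\<close>

lemma eventually_abs_q1_le: "\<forall>\<^sub>F x in at_top. \<bar>q1 x\<bar> \<le> 1 / 4"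
proof -
  have "((\<lambda>x. x * q1 x * (1 / x)) \<longlongrightarrow> (\<nu> + 1) * 0) at_top"
    by (intro tendsto_mult hastings_mcleod_at_top[OF q1]) real_asymp
  then have "((\<lambda>x. x * q1 x * (1 / x)) \<longlongrightarrow> 0) at_top"
    by simp
  from tendstoD[OF this, of "1 / 4"] have "\<forall>\<^sub>F x in at_top. \<bar>x * q1 x * (1 / x)\<bar> < 1 / 4"
    by simp
  then show ?thesis
    using eventually_gt_at_top[of 0] by eventually_elim simp
qed

lemma frequently_abs_deriv_q1_le: "\<exists>\<^sub>F x in at_top. \<bar>deriv q1 x\<bar> \<le> 1 / 2"
  using frequently_deriv_bound[OF deriv_q1 eventually_abs_q1_le] by (simp add: mono_def)

text \<open>With the integrating factor \<open>exp (2 * Q)\<close> the function \<open>N\<close> is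
  strictly increasing. Toward minus infinity the factor decays exponentially while
  \<open>- F\<close> grows at most linearly at suitable points, so \<open>N\<close> cannot stay
  negative there.\<close>

lemma F_pos: "F x > 0"
proof -
  obtain Q where Q: "\<And>x. (Q has_real_derivative q x) (at x)"
    using antiderivative_ex DERIV_isCont deriv_q by metis
  define N where "N x = F x * exp (2 * Q x)" for x
  have N: "(N has_real_derivative a * exp (2 * Q x)) (at x)" for x
    unfolding N_def by (auto intro!: derivative_eq_intros deriv_F Q simp: algebra_simps)
  have "\<forall>\<^sub>F x in at_top. - N (- x) \<le> 0"
  proof (rule frequently_small_nondecreasing_nonpos)
    show "\<forall>\<^sub>F x in at_top. ((\<lambda>x. - N (- x)) has_real_derivative a * exp (2 * Q (- x))) (at x)
        \<and> 0 \<le> a * exp (2 * Q (- x))"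
      using DERIV_minus[OF deriv_reflect[OF N]] a_pos by simp
  next
    fix e :: real assume "e > 0"
    obtain T where T: "\<And>x. x \<ge> T \<Longrightarrow> 1 \<le> q (- x) \<and> q (- x) \<le> x"
      using hastings_mcleod_at_bot_bounds[OF q] unfolding eventually_at_top_linorder by blast
    \<comment> \<open>For \<open>y \<ge> T\<close> the bound \<open>q (- y) \<ge> 1\<close> makes
      \<open>Q (- y) + y\<close> nonincreasing in \<open>y\<close>, so
      \<open>exp (2 * Q (- x))\<close> is at most a multiple of
      \<open>exp (- 2 * x)\<close>.\<close>
    have QT: "Q (- x) \<le> Q (- T) + T - x" if "x \<ge> T" for x
    proof -
      have "Q (- x) + x \<le> Q (- T) + T"
      proof (rule DERIV_nonpos_imp_nonincreasing[OF that])
        fix y assume "T \<le> y"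
        then show "\<exists>d. ((\<lambda>x. Q (- x) + x) has_real_derivative d) (at y) \<and> d \<le> 0"
          using T[of y] DERIV_add[OF deriv_reflect[OF Q] DERIV_ident]
          by (intro exI[of _ "- q (- y) + 1"]) auto
      qed
      then show ?thesis by simp
    qed
    have "((\<lambda>x. (5 * x + 4) * exp (2 * (Q (- T) + T - x))) \<longlongrightarrow> 0) at_top"
      by real_asymp
    from order_tendstoD(2)[OF this \<open>e > 0\<close>]
    have "\<forall>\<^sub>F x in at_top. (5 * x + 4) * exp (2 * (Q (- T) + T - x)) < e \<and> x \<ge> T \<and> x \<ge> 0"
      using eventually_ge_at_top[of T] eventually_ge_at_top[of 0] by eventually_elim simp
    from frequently_eventually_frequently[OF frequently_abs_deriv_q_le this]
    show "\<exists>\<^sub>F x in at_top. - N (- x) < e"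
    proof (rule frequently_elim1)
      fix x assume x: "\<bar>deriv q (- x)\<bar> \<le> 2 * (x + 1) \<and>
         (5 * x + 4) * exp (2 * (Q (- T) + T - x)) < e \<and> T \<le> x \<and> 0 \<le> x"
      \<comment> \<open>Dropping the square leaves \<open>2 * deriv q (- x) + x\<close>, and the
        derivative bound gives \<open>4 * (x + 1) + x\<close>.\<close>
      have "- F (- x) \<le> 2 * deriv q (- x) + x"
        by (simp add: F_def)
      also have "\<dots> \<le> 5 * x + 4"
        using x by (auto simp: abs_le_iff)
      finally have "- F (- x) * exp (2 * Q (- x)) \<le> (5 * x + 4) * exp (2 * (Q (- T) + T - x))"
        using QT[of x] x by (intro mult_mono) auto
      then show "- N (- x) < e"
        using x by (simp add: N_def)
    qed
  qed
  then obtain X where X: "\<And>x. x \<ge> X \<Longrightarrow> N (- x) \<ge> 0"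
    unfolding eventually_at_top_linorder by auto
  \<comment> \<open>A point strictly to the left of \<open>x\<close> in the region where
    \<open>N\<close> is known to be nonnegative.\<close>
  define y where "y = min (- X) (x - 1)"
  have "0 \<le> N y"
    using X[of "- y"] by (simp add: y_def)
  also have "N y < N x"
    by (rule DERIV_pos_imp_increasing) (use N a_pos in \<open>auto simp: y_def intro!: exI\<close>)
  finally show ?thesis
    by (simp add: N_def zero_less_mult_iff)
qed

text \<open>Here \<open>N\<close> is strictly decreasing, so positivity is carried leftward from a
  point \<open>y > 1\<close> where \<open>2 * deriv q1 y \<ge> - 1\<close> makes \<open>G y\<close>
  positive.\<close>

lemma G_pos: "G x > 0"
proof -
  obtain Q where Q: "\<And>x. (Q has_real_derivative q1 x) (at x)"
    using antiderivative_ex DERIV_isCont deriv_q1 by metis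
  define N where "N x = G x * exp (- 2 * Q x)" for x
  have N: "(N has_real_derivative - a * exp (- 2 * Q x)) (at x)" for x
    unfolding N_def by (auto intro!: derivative_eq_intros deriv_G Q simp: algebra_simps)
  obtain y where y: "\<bar>deriv q1 y\<bar> \<le> 1 / 2" "y > max x 1"
    using frequently_ex[OF frequently_eventually_frequently[OF frequently_abs_deriv_q1_le
      eventually_gt_at_top[of "max x 1"]]] by blast
  have "0 \<le> q1 y ^ 2" "- 1 \<le> 2 * deriv q1 y" "1 < y"
    using y by (simp, linarith, simp)
  then have "0 < G y"
    unfolding G_def by linarith
  then have "0 < N y"
    by (simp add: N_def)
  also have "N y < N x"
    by (rule DERIV_neg_imp_decreasing) (use N a_pos y in \<open>auto intro!: exI\<close>)
  finally show ?thesis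
    by (simp add: N_def zero_less_mult_iff)
qed

section \<open>Asymptotics of \<open>F\<close> and \<open>G\<close> at both ends\<close>

lemma F_at_top: "((\<lambda>x. F x / x) \<longlongrightarrow> 1) at_top"
\<comment> \<open>For \<open>F x / x\<close> the time is \<open>a * ln x\<close>, and the
  coefficient \<open>(2 * (x * q x) + 1) / a\<close> tends to
  \<open>(2 * \<nu> + 1) / a = 1\<close>.\<close>
proof (rule stable_linear_ode_tendsto_1)
  show "\<forall>\<^sub>F x in at_top. ((\<lambda>x. F x / x) has_real_derivative
      a / x * (1 - (2 * (x * q x) + 1) / a * (F x / x))) (at x)"
    using eventually_gt_at_top[of 0]
  proof eventually_elim
    case (elim x)
    show ?case
      using elim a_pos
      by (auto intro!: derivative_eq_intros deriv_F simp: field_simps)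
  qed
  show "\<forall>\<^sub>F x in at_top. ((\<lambda>x. a * ln x) has_real_derivative a / x) (at x)"
    using eventually_gt_at_top[of 0] by eventually_elim (auto intro!: derivative_eq_intros)
  show "filterlim (\<lambda>x. a * ln x) at_top at_top"
    using a_pos by real_asymp
  have "((\<lambda>x. (2 * (x * q x) + 1) / a) \<longlongrightarrow> (2 * \<nu> + 1) / a) at_top"
    by (intro tendsto_intros hastings_mcleod_at_top[OF q]) (use a_pos in simp)
  then show "((\<lambda>x. (2 * (x * q x) + 1) / a) \<longlongrightarrow> 1) at_top"
    using a_pos by (simp add: a_def)
  show "\<forall>\<^sub>F x in at_top. F x / x > 0" "\<forall>\<^sub>F x in at_top. a / x \<ge> 0"
    using eventually_gt_at_top[of 0] by (eventually_elim, use a_pos F_pos in simp)+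
qed

lemma G_at_top: "((\<lambda>x. G x / x) \<longlongrightarrow> 1) at_top"
\<comment> \<open>The coefficient \<open>(2 * (x * q1 x) - 1) / a\<close> tends to
  \<open>(2 * (\<nu> + 1) - 1) / a = 1\<close>. The bound 3 comes from
  \<open>G x \<le> 1 / 8 + 1 + x\<close> at points \<open>x \<ge> 1\<close> with small
  \<open>deriv q1 x\<close>.\<close>
proof (rule unstable_linear_ode_tendsto_1[where B = "\<lambda>_. 3"])
  show "\<forall>\<^sub>F x in at_top. ((\<lambda>x. G x / x) has_real_derivative
      a / x * ((2 * (x * q1 x) - 1) / a * (G x / x) - 1)) (at x)"
    using eventually_gt_at_top[of 0]
  proof eventually_elim
    case (elim x)
    show ?case
      using elim a_pos
      by (auto intro!: derivative_eq_intros deriv_G simp: field_simps)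
  qed
  show "\<forall>\<^sub>F x in at_top. ((\<lambda>x. a * ln x) has_real_derivative a / x) (at x)"
    using eventually_gt_at_top[of 0] by eventually_elim (auto intro!: derivative_eq_intros)
  show "filterlim (\<lambda>x. a * ln x) at_top at_top" "((\<lambda>x. 3 * exp (- (a * ln x) / 2)) \<longlongrightarrow> 0) at_top"
    using a_pos by real_asymp+
  have "((\<lambda>x. (2 * (x * q1 x) - 1) / a) \<longlongrightarrow> (2 * (\<nu> + 1) - 1) / a) at_top"
    by (intro tendsto_intros hastings_mcleod_at_top[OF q1]) (use a_pos in simp)
  moreover have "2 * (\<nu> + 1) - 1 = a"
    by (simp add: a_def)
  ultimately show "((\<lambda>x. (2 * (x * q1 x) - 1) / a) \<longlongrightarrow> 1) at_top"
    using a_pos by simp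
  from frequently_eventually_frequently[OF frequently_abs_deriv_q1_le
      eventually_conj[OF eventually_abs_q1_le eventually_ge_at_top[of 1]]]
  show "\<exists>\<^sub>F x in at_top. G x / x \<le> 3"
  proof (rule frequently_elim1)
    fix x assume x: "\<bar>deriv q1 x\<bar> \<le> 1 / 2 \<and> \<bar>q1 x\<bar> \<le> 1 / 4 \<and> 1 \<le> x"
    have "q1 x ^ 2 \<le> (1 / 4) ^ 2"
      using x by (intro power2_le_iff_abs_le[THEN iffD2]) auto
    then have "G x \<le> 3 * x"
      using x unfolding G_def by (auto simp: abs_le_iff power2_eq_square)
    then show "G x / x \<le> 3"
      using x by (simp add: field_simps)
  qed
  show "\<forall>\<^sub>F x in at_top. G x / x > 0" "\<forall>\<^sub>F x in at_top. a / x \<ge> 0"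
    using eventually_gt_at_top[of 0] by (eventually_elim, use a_pos G_pos in simp)+
qed

lemma deriv_sqrt_two_mult:
  assumes "x > 0"
  shows "((\<lambda>x. sqrt (2 * x)) has_real_derivative inverse (sqrt (2 * x))) (at x)"
  using DERIV_chain2[OF DERIV_real_sqrt DERIV_cmult[OF DERIV_ident], of 2 x] assms by simp

text \<open>At minus infinity the balance of \<open>a\<close> against \<open>2 * q * F\<close>
  predicts that \<open>F (- x)\<close> behaves like \<open>a / sqrt (2 * x)\<close>, and likewise
  for \<open>G\<close>; hence this normalization. The term \<open>1 / (2 * x * sqrt (2 * x))\<close>
  comes from differentiating the square root.\<close>

lemma deriv_reflect_times_sqrt:
  assumes "\<And>x. (f has_real_derivative f' x) (at x)" "x > 0"
  shows "((\<lambda>x. f (- x) * sqrt (2 * x) / a) has_real_derivative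
           sqrt (2 * x) * (- f' (- x) / a + 1 / (2 * x * sqrt (2 * x)) * (f (- x) * sqrt (2 * x) / a))) (at x)"
proof -
  have "((\<lambda>x. f (- x) * sqrt (2 * x) / a) has_real_derivative
      (- f' (- x) * sqrt (2 * x) + inverse (sqrt (2 * x)) * f (- x)) / a) (at x)"
    by (rule DERIV_cdivide[OF DERIV_mult[OF deriv_reflect[OF assms(1)] deriv_sqrt_two_mult[OF assms(2)]]])
  moreover have "(- d * S + inverse S * y) / a = S * (- d / a + 1 / (S * S * S) * (y * S / a))"
    if "S > 0" for d y S
    using that a_pos by (simp add: field_simps)
  ultimately show ?thesis
    using assms(2) by simp
qed

text \<open>This function, one third of the power \<open>3 / 2\<close> of \<open>2 * x\<close>, is
  the time \<open>K\<close> belonging to the rate \<open>sqrt (2 * x)\<close>.\<close>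

lemma deriv_two_thirds_power:
  assumes "x > 0"
  shows "((\<lambda>x. 2 * x * sqrt (2 * x) / 3) has_real_derivative sqrt (2 * x)) (at x)"
proof -
  have "((\<lambda>x. 2 * x * sqrt (2 * x) / 3) has_real_derivative
      (2 * sqrt (2 * x) + inverse (sqrt (2 * x)) * (2 * x)) / 3) (at x)"
    using DERIV_cdivide[OF DERIV_mult[OF DERIV_cmult[OF DERIV_ident] deriv_sqrt_two_mult[OF assms]], of 2 3]
    by simp
  moreover have "inverse (sqrt (2 * x)) * (2 * x) = sqrt (2 * x)"
    using assms real_div_sqrt[of "2 * x"] by (simp add: field_simps)
  ultimately show ?thesis by simp
qed

lemma F_at_bot: "((\<lambda>x. F (- x) * sqrt (2 * x) / a) \<longlongrightarrow> 1) at_top"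
\<comment> \<open>Reflection reverses time, so the equation for \<open>F\<close>, stable at plus
  infinity, is unstable here. The factor \<open>10 * x^2\<close> dominates
  \<open>2 * x^2 + 4 * x + 4\<close>, which bounds \<open>F (- x)\<close> at suitable
  points.\<close>
proof (rule unstable_linear_ode_tendsto_1[where B = "\<lambda>x. 10 * x^2 * sqrt (2 * x) / a"
      and c = "\<lambda>x. 2 * q (- x) / sqrt (2 * x) + 1 / (2 * x * sqrt (2 * x))"
      and k = "\<lambda>x. sqrt (2 * x)" and K = "\<lambda>x. 2 * x * sqrt (2 * x) / 3"])
  show "\<forall>\<^sub>F x in at_top. ((\<lambda>x. F (- x) * sqrt (2 * x) / a) has_real_derivative
      sqrt (2 * x) * ((2 * q (- x) / sqrt (2 * x) + 1 / (2 * x * sqrt (2 * x)))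
         * (F (- x) * sqrt (2 * x) / a) - 1)) (at x)"
    using eventually_gt_at_top[of 0]
  proof eventually_elim
    case (elim x)
    have "- (a - 2 * Q * f) / a + e * (f * S / a) = (2 * Q / S + e) * (f * S / a) - 1"
      if "S > 0" for Q f e S
      using that a_pos by (simp add: field_simps)
    moreover have "sqrt (2 * x) > 0"
      using elim by simp
    ultimately show ?case
      using deriv_reflect_times_sqrt[OF deriv_F elim] by (simp only:)
  qed
  show "\<forall>\<^sub>F x in at_top. ((\<lambda>x. 2 * x * sqrt (2 * x) / 3) has_real_derivative sqrt (2 * x)) (at x)"
    using eventually_gt_at_top[of 0] by eventually_elim (rule deriv_two_thirds_power)
  show "filterlim (\<lambda>x. 2 * x * sqrt (2 * x) / 3) at_top at_top"
    by real_asymp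
  show "((\<lambda>x. 10 * x^2 * sqrt (2 * x) / a * exp (- (2 * x * sqrt (2 * x) / 3) / 2)) \<longlongrightarrow> 0) at_top"
    using a_pos by real_asymp
  have "((\<lambda>x. 2 * q (- x) / sqrt (2 * x) + 1 / (2 * x * sqrt (2 * x))) \<longlongrightarrow> 1 + 0) at_top"
    by (intro tendsto_add hastings_mcleod_at_bot[OF q]) real_asymp
  then show "((\<lambda>x. 2 * q (- x) / sqrt (2 * x) + 1 / (2 * x * sqrt (2 * x))) \<longlongrightarrow> 1) at_top"
    by simp
  from frequently_eventually_frequently[OF frequently_abs_deriv_q_le
      eventually_conj[OF hastings_mcleod_at_bot_bounds[OF q] eventually_ge_at_top[of 1]]]
  show "\<exists>\<^sub>F x in at_top. F (- x) * sqrt (2 * x) / a \<le> 10 * x^2 * sqrt (2 * x) / a"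
  proof (rule frequently_elim1)
    fix x assume x: "\<bar>deriv q (- x)\<bar> \<le> 2 * (x + 1) \<and> (1 \<le> q (- x) \<and> q (- x) \<le> x) \<and> 1 \<le> x"
    have "q (- x) ^ 2 \<le> x ^ 2"
      using x by (intro power_mono) auto
    moreover have "1 \<le> x^2" "x \<le> x^2"
      using x by (simp_all add: self_le_power)
    moreover have "- deriv q (- x) \<le> 2 * x + 2" "1 \<le> x"
      using x by (auto simp: abs_le_iff)
    ultimately have "F (- x) \<le> 10 * x^2"
      unfolding F_def by linarith
    then show "F (- x) * sqrt (2 * x) / a \<le> 10 * x^2 * sqrt (2 * x) / a"
      using x a_pos by (intro divide_right_mono mult_right_mono) auto
  qed
  show "\<forall>\<^sub>F x in at_top. F (- x) * sqrt (2 * x) / a > 0" "\<forall>\<^sub>F x in at_top. sqrt (2 * x) \<ge> 0"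
    using eventually_gt_at_top[of 0] by (eventually_elim, use a_pos F_pos in simp)+
qed

lemma G_at_bot: "((\<lambda>x. G (- x) * sqrt (2 * x) / a) \<longlongrightarrow> 1) at_top"
\<comment> \<open>Reflection makes the equation for \<open>G\<close> stable, on the same time scale
  as for \<open>F\<close>.\<close>
proof (rule stable_linear_ode_tendsto_1[where c = "\<lambda>x. 2 * q1 (- x) / sqrt (2 * x) - 1 / (2 * x * sqrt (2 * x))"
      and k = "\<lambda>x. sqrt (2 * x)" and K = "\<lambda>x. 2 * x * sqrt (2 * x) / 3"])
  show "\<forall>\<^sub>F x in at_top. ((\<lambda>x. G (- x) * sqrt (2 * x) / a) has_real_derivative
      sqrt (2 * x) * (1 - (2 * q1 (- x) / sqrt (2 * x) - 1 / (2 * x * sqrt (2 * x)))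
         * (G (- x) * sqrt (2 * x) / a))) (at x)"
    using eventually_gt_at_top[of 0]
  proof eventually_elim
    case (elim x)
    have "- (2 * Q * f - a) / a + e * (f * S / a) = 1 - (2 * Q / S - e) * (f * S / a)"
      if "S > 0" for Q f e S
      using that a_pos by (simp add: field_simps)
    moreover have "sqrt (2 * x) > 0"
      using elim by simp
    ultimately show ?case
      using deriv_reflect_times_sqrt[OF deriv_G elim] by (simp only:)
  qed
  show "\<forall>\<^sub>F x in at_top. ((\<lambda>x. 2 * x * sqrt (2 * x) / 3) has_real_derivative sqrt (2 * x)) (at x)"
    using eventually_gt_at_top[of 0] by eventually_elim (rule deriv_two_thirds_power)
  show "filterlim (\<lambda>x. 2 * x * sqrt (2 * x) / 3) at_top at_top"
    by real_asymp
  have "((\<lambda>x. 2 * q1 (- x) / sqrt (2 * x) - 1 / (2 * x * sqrt (2 * x))) \<longlongrightarrow> 1 - 0) at_top"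
    by (intro tendsto_diff hastings_mcleod_at_bot[OF q1]) real_asymp
  then show "((\<lambda>x. 2 * q1 (- x) / sqrt (2 * x) - 1 / (2 * x * sqrt (2 * x))) \<longlongrightarrow> 1) at_top"
    by simp
  show "\<forall>\<^sub>F x in at_top. G (- x) * sqrt (2 * x) / a > 0" "\<forall>\<^sub>F x in at_top. sqrt (2 * x) \<ge> 0"
    using eventually_gt_at_top[of 0] by (eventually_elim, use a_pos G_pos in simp)+
qed

section \<open>Equality of \<open>F\<close> and \<open>G\<close> and the Baecklund
  transformation\<close>

lemma ln_F_G_at_top: "((\<lambda>x. ln (F x) - ln (G x)) \<longlongrightarrow> 0) at_top"
proof -
  have "((\<lambda>x. ln (F x / x) - ln (G x / x)) \<longlongrightarrow> ln 1 - ln 1) at_top"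
    by (intro tendsto_diff tendsto_ln F_at_top G_at_top) auto
  then have "((\<lambda>x. ln (F x / x) - ln (G x / x)) \<longlongrightarrow> 0) at_top"
    by simp
  then show ?thesis
  proof (rule Lim_transform_eventually)
    show "\<forall>\<^sub>F x in at_top. ln (F x / x) - ln (G x / x) = ln (F x) - ln (G x)"
      using eventually_gt_at_top[of 0]
    proof eventually_elim
      case (elim x)
      then show ?case
        using F_pos[of x] G_pos[of x] by (simp add: ln_div)
    qed
  qed
qed

lemma ln_F_G_at_bot: "((\<lambda>x. ln (F x) - ln (G x)) \<longlongrightarrow> 0) at_bot"
proof -
  have "((\<lambda>x. ln (F (- x) * sqrt (2 * x) / a) - ln (G (- x) * sqrt (2 * x) / a)) \<longlongrightarrow> 0) at_top"
    using tendsto_diff[OF tendsto_ln[OF F_at_bot one_neq_zero] tendsto_ln[OF G_at_bot one_neq_zero]]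
    by (simp only: ln_one diff_zero)
  then have "((\<lambda>x. ln (F (- x)) - ln (G (- x))) \<longlongrightarrow> 0) at_top"
  proof (rule Lim_transform_eventually)
    show "\<forall>\<^sub>F x in at_top. ln (F (- x) * sqrt (2 * x) / a) - ln (G (- x) * sqrt (2 * x) / a)
        = ln (F (- x)) - ln (G (- x))"
      using eventually_gt_at_top[of 0]
    proof eventually_elim
      case (elim x)
      define w where "w = sqrt (2 * x) / a"
      have "w > 0"
        using elim a_pos by (simp add: w_def)
      then have "ln (F (- x) * w) - ln (G (- x) * w) = ln (F (- x)) - ln (G (- x))"
        using F_pos[of "- x"] G_pos[of "- x"] by (simp add: ln_mult)
      then show ?case
        by (simp only: w_def times_divide_eq_right)
    qed
  qed
  then show ?thesis
    by (simp add: filterlim_at_bot_mirror)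
qed

lemma F_eq_G: "F x = G x"
proof -
  define f where "f x = ln (F x) - ln (G x)" for x
  define f' where "f' x = a / F x + a / G x - 2 * (q x + q1 x)" for x
  define f'' where "f'' x = - a * (a - 2 * q x * F x) / F x ^ 2 - a * (2 * q1 x * G x - a) / G x ^ 2
      - 2 * (deriv q x + deriv q1 x)" for x
  have f: "(f has_real_derivative f' x) (at x)" for x
  proof -
    have "(f has_real_derivative
        1 / F x * (a - 2 * q x * F x) - 1 / G x * (2 * q1 x * G x - a)) (at x)"
      unfolding f_def by (intro DERIV_diff DERIV_chain2[OF DERIV_ln_divide] deriv_F deriv_G F_pos G_pos)
    moreover have "1 / F x * (a - 2 * q x * F x) - 1 / G x * (2 * q1 x * G x - a) = f' x"
      unfolding f'_def using F_pos[of x] G_pos[of x]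
      by (simp add: right_diff_distrib)
    ultimately show ?thesis by simp
  qed
  have f': "(f' has_real_derivative f'' x) (at x)" for x
  proof -
    have "(f' has_real_derivative (0 * F x - a * (a - 2 * q x * F x)) / (F x * F x)
        + (0 * G x - a * (2 * q1 x * G x - a)) / (G x * G x) - 2 * (deriv q x + deriv q1 x)) (at x)"
      unfolding f'_def using F_pos[of x] G_pos[of x]
      by (intro DERIV_diff DERIV_add DERIV_divide DERIV_const DERIV_cmult
            deriv_F deriv_G deriv_q deriv_q1) auto
    then show ?thesis
      by (simp add: f''_def power2_eq_square)
  qed
  \<comment> \<open>At a critical point \<open>q x + q1 x\<close> is the mean of
    \<open>a / F x\<close> and \<open>a / G x\<close>. The definitions of \<open>F\<close> and
    \<open>G\<close> trade the derivatives of \<open>q\<close> and \<open>q1\<close> for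
    \<open>F x - G x\<close>, and the remaining terms collapse to a difference of squares. Both
    contributions have the sign of \<open>f x\<close>.\<close>
  have crit: "f'' x = F x - G x + ((a / G x)^2 - (a / F x)^2) / 2" if "f' x = 0" for x
  proof -
    define A where "A = a / F x"
    define B where "B = a / G x"
    have sum: "2 * (q x + q1 x) = A + B"
      using that by (simp add: f'_def A_def B_def)
    have "f'' x = - A * (A - 2 * q x) - B * (2 * q1 x - B) - 2 * (deriv q x + deriv q1 x)"
    proof -
      have "- a * (a - 2 * q x * F x) / F x ^ 2 = - A * (A - 2 * q x)"
        unfolding A_def using F_pos[of x] by (simp add: field_simps power2_eq_square)
      moreover have "a * (2 * q1 x * G x - a) / G x ^ 2 = B * (2 * q1 x - B)"
        unfolding B_def using G_pos[of x] by (simp add: field_simps power2_eq_square)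
      ultimately show ?thesis
        unfolding f''_def by simp
    qed
    moreover have "- 2 * (deriv q x + deriv q1 x) = F x - G x + 2 * (q1 x - q x) * (q x + q1 x)"
      by (simp add: F_def G_def power2_eq_square algebra_simps)
    ultimately have "f'' x = F x - G x - A * (A - 2 * q x) - B * (2 * q1 x - B)
        + 2 * (q1 x - q x) * (q x + q1 x)"
      by simp
    also have "\<dots> = F x - G x + (B^2 - A^2) / 2"
    proof -
      have A: "A = 2 * (q x + q1 x) - B" using sum by simp
      show ?thesis unfolding A by (simp add: field_simps power2_eq_square)
    qed
    finally show ?thesis by (simp add: A_def B_def)
  qed
  have "f x \<le> 0"
  proof (rule max_principle_vanishing_at_infinity[OF f f'])
    fix y assume "f y > 0" "f' y = 0"
    then have "G y < F y"
      using F_pos[of y] G_pos[of y] by (simp add: f_def)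
    moreover from this have "(a / F y)^2 < (a / G y)^2"
      using F_pos[of y] G_pos[of y] a_pos by (intro power_strict_mono divide_strict_left_mono) auto
    ultimately show "f'' y > 0"
      unfolding crit[OF \<open>f' y = 0\<close>] by (intro add_pos_pos) simp_all
  qed (use ln_F_G_at_top ln_F_G_at_bot in \<open>simp_all add: f_def[abs_def]\<close>)
  \<comment> \<open>The formula for \<open>f''\<close> is antisymmetric under exchange of
    \<open>F\<close> and \<open>G\<close>, so the argument repeats for \<open>- f\<close>.\<close>
  moreover have "- f x \<le> 0"
  proof (rule max_principle_vanishing_at_infinity[OF DERIV_minus[OF f] DERIV_minus[OF f']])
    fix y assume "- f y > 0" "- f' y = 0"
    then have "F y < G y"
      using F_pos[of y] G_pos[of y] by (simp add: f_def)
    moreover from this have "(a / G y)^2 < (a / F y)^2"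
      using F_pos[of y] G_pos[of y] a_pos by (intro power_strict_mono divide_strict_left_mono) auto
    ultimately have "0 < (G y - F y) + ((a / F y)^2 - (a / G y)^2) / 2"
      by (intro add_pos_pos) simp_all
    then show "- f'' y > 0"
      using crit[of y] \<open>- f' y = 0\<close> by (simp add: diff_divide_distrib)
  qed (use tendsto_minus[OF ln_F_G_at_top] tendsto_minus[OF ln_F_G_at_bot] in \<open>simp_all add: f_def[abs_def]\<close>)
  ultimately have "ln (F x) = ln (G x)"
    by (simp add: f_def)
  then show ?thesis
    using F_pos[of x] G_pos[of x] by simp
qed

lemma deriv_q1_eq: "deriv q1 x = q x ^ 2 - deriv q x - q1 x ^ 2"
  using F_eq_G[of x] unfolding F_def G_def by linarith

text \<open>As \<open>F\<close> and \<open>G\<close> are one function, their two equations give the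
  same derivative: \<open>a - 2 * q x * F x = 2 * q1 x * F x - a\<close>.\<close>

lemma q_plus_q1: "q1 x + q x = a / F x"
proof -
  have "a - 2 * q x * F x = 2 * q1 x * G x - a"
    using deriv_F[of x] deriv_G[of x] F_eq_G by (metis DERIV_unique ext)
  then show ?thesis
    using F_pos[of x] F_eq_G[of x] by (simp add: field_simps)
qed

text \<open>Once \<open>deriv q1\<close> is eliminated, the difference factors through
  \<open>(q1 x + q x) * F x\<close>, whose value is \<open>2 * \<nu> + 1\<close>; the terms with
  \<open>\<nu>\<close> then cancel.\<close>

lemma pII_u_diff: "pII_u (\<nu> + 1) q1 x - pII_u \<nu> q x = q1 x + q x"
proof -
  have "(q1 x + q x) * (2 * q x ^ 2 - 2 * deriv q x + x) = 2 * \<nu> + 1"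
    using q_plus_q1[of x] F_pos[of x] by (simp add: F_def a_def)
  moreover have "pII_u (\<nu> + 1) q1 x - pII_u \<nu> q x = 2 * q1 x + 2 * \<nu> * (q1 x - q x)
      - (q1 x - q x) * ((q1 x + q x) * (2 * q x ^ 2 - 2 * deriv q x + x))"
    unfolding pII_u_def deriv_q1_eq by (simp add: algebra_simps power_numeral_reduce)
  ultimately show ?thesis
    by (simp add: algebra_simps)
qed

end

section \<open>Linear systems on the slit plane\<close>

lemma has_vector_derivative_vec:
  fixes f :: "real \<Rightarrow> 'a::euclidean_space ^ 'n"
  assumes "\<And>i. ((\<lambda>t. f t $ i) has_vector_derivative f' $ i) (at t)"
  shows "(f has_vector_derivative f') (at t)"
proof -
  have "((\<lambda>t. f t \<bullet> b) has_derivative (\<lambda>x. (x *\<^sub>R f') \<bullet> b)) (at t)" if "b \<in> Basis" for b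
  proof -
    from that obtain i u where b: "b = axis i u"
      by (auto simp: Basis_vec_def)
    have "((\<lambda>t. f t $ i \<bullet> u) has_derivative (\<lambda>x. (x *\<^sub>R f' $ i) \<bullet> u)) (at t)"
      using assms[of i] unfolding has_vector_derivative_def by (rule has_derivative_inner_left)
    then show ?thesis
      by (simp add: b inner_axis)
  qed
  then show ?thesis
    unfolding has_vector_derivative_def has_derivative_componentwise_within[of f] by blast
qed

lemma matrix_mult_add_rdistrib: "(A + B) ** C = A ** C + B ** C"
  for A B :: "'a::semiring_1 ^ 'n ^ 'm"
  by (simp add: vec_eq_iff matrix_matrix_mult_def distrib_right sum.distrib)

lemma matrix_mult_diff_ldistrib: "A ** (B - C) = A ** B - A ** C"
  for A :: "'a::ring_1 ^ 'n ^ 'm"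
  by (simp add: vec_eq_iff matrix_matrix_mult_def right_diff_distrib sum_subtractf)

lemma bilinear_matrix_mult: "bilinear ((**) :: complex ^ 'n ^ 'n \<Rightarrow> complex ^ 'n ^ 'n \<Rightarrow> complex ^ 'n ^ 'n)"
  unfolding bilinear_def
  by (auto intro!: linearI simp: vec_eq_iff ring_distribs sum.distrib
      matrix_matrix_mult_def scaleR_sum_right)

text \<open>Gronwall's argument: \<open>exp (- 2 * K * t)\<close> times the squared norm of
  \<open>Y t\<close> is nonincreasing and starts at 0.\<close>

lemma linear_ode_zero:
  fixes Y Y' :: "real \<Rightarrow> 'a::real_inner"
  assumes Y: "\<And>t. t \<in> {0..1} \<Longrightarrow> (Y has_vector_derivative Y' t) (at t)"
    and bound: "\<And>t. t \<in> {0..1} \<Longrightarrow> norm (Y' t) \<le> K * norm (Y t)"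
    and "Y 0 = 0"
  shows "Y 1 = 0"
proof -
  define g where "g t = exp (- 2 * K * t) * (Y t \<bullet> Y t)" for t
  have "g 1 \<le> g 0"
  proof (rule DERIV_nonpos_imp_nonincreasing[where f = g and a = 0 and b = 1])
    fix t :: real assume "0 \<le> t" "t \<le> 1"
    then have t: "t \<in> {0..1}" by simp
    have "((\<lambda>t. Y t \<bullet> Y t) has_real_derivative 2 * (Y t \<bullet> Y' t)) (at t)"
      using has_derivative_inner[OF Y[OF t, unfolded has_vector_derivative_def]
          Y[OF t, unfolded has_vector_derivative_def]]
      by (simp add: has_field_derivative_def inner_commute algebra_simps mult_commute_abs)
    then have "(g has_real_derivative
        - 2 * K * exp (- 2 * K * t) * (Y t \<bullet> Y t) + exp (- 2 * K * t) * (2 * (Y t \<bullet> Y' t))) (at t)"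
      unfolding g_def by (auto intro!: derivative_eq_intros)
    moreover have "Y t \<bullet> Y' t \<le> K * (Y t \<bullet> Y t)"
    proof -
      have "Y t \<bullet> Y' t \<le> norm (Y t) * norm (Y' t)"
        by (rule norm_cauchy_schwarz)
      also have "\<dots> \<le> norm (Y t) * (K * norm (Y t))"
        using bound[OF t] by (rule mult_left_mono) simp
      also have "\<dots> = K * (Y t \<bullet> Y t)"
        by (simp add: power2_norm_eq_inner[symmetric] power2_eq_square)
      finally show ?thesis .
    qed
    then have "exp (- 2 * K * t) * (Y t \<bullet> Y' t) \<le> exp (- 2 * K * t) * (K * (Y t \<bullet> Y t))"
      by (rule mult_left_mono) simp
    then have "- 2 * K * exp (- 2 * K * t) * (Y t \<bullet> Y t) + exp (- 2 * K * t) * (2 * (Y t \<bullet> Y' t)) \<le> 0"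
      by (simp add: algebra_simps)
    ultimately show "\<exists>y. (g has_real_derivative y) (at t) \<and> y \<le> 0"
      by blast
  qed simp
  then have "exp (- 2 * K) * (Y 1 \<bullet> Y 1) \<le> 0"
    using \<open>Y 0 = 0\<close> by (simp add: g_def)
  then show ?thesis
    by (simp add: mult_le_0_iff power2_norm_eq_inner[symmetric])
qed

text \<open>The plane cut along the negative real axis is starlike with respect to every point of the
  positive real axis.\<close>

lemma matrix_ode_zero_on_slit_plane:
  fixes Y U :: "complex \<Rightarrow> complex ^ 'n ^ 'n"
  assumes deriv: "\<And>z i j. z \<notin> \<real>\<^sub>\<le>\<^sub>0 \<Longrightarrow>
      ((\<lambda>w. Y w $ i $ j) has_field_derivative (U z ** Y z) $ i $ j) (at z)"
    and U: "\<And>i j. continuous_on (- \<real>\<^sub>\<le>\<^sub>0) (\<lambda>z. U z $ i $ j)"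
    and x: "x > 0" "Y (of_real x) = 0"
    and z: "z \<notin> \<real>\<^sub>\<le>\<^sub>0"
  shows "Y z = 0"
proof -
  define \<gamma> where "\<gamma> t = of_real x + of_real t * (z - of_real x)" for t :: real
  have \<gamma>: "\<gamma> t \<notin> \<real>\<^sub>\<le>\<^sub>0" if t: "t \<in> {0..1}" for t
  proof
    assume neg: "\<gamma> t \<in> \<real>\<^sub>\<le>\<^sub>0"
    then have im: "t = 0 \<or> Im z = 0" and re: "(1 - t) * x + t * Re z \<le> 0"
      by (auto simp: \<gamma>_def complex_nonpos_Reals_iff algebra_simps)
    have "t \<noteq> 0"
      using re x(1) by auto
    with im z have "Re z > 0"
      by (auto simp: complex_nonpos_Reals_iff)
    then have "t * Re z > 0" "(1 - t) * x \<ge> 0"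
      using \<open>t \<noteq> 0\<close> t x(1) by auto
    with re show False by simp
  qed
  have "\<exists>B>0. \<forall>(X :: complex ^ 'n ^ 'n) (Y :: complex ^ 'n ^ 'n). norm (X ** Y) \<le> B * norm X * norm Y"
    by (rule bilinear_bounded_pos[OF bilinear_matrix_mult])
  then obtain B where B: "B > 0" "\<And>(X :: complex ^ 'n ^ 'n) (Y :: complex ^ 'n ^ 'n). norm (X ** Y) \<le> B * norm X * norm Y"
    by blast
  have "continuous_on {0..1} (\<lambda>t. norm (U (\<gamma> t)))"
  proof (intro continuous_on_norm)
    have "continuous_on {0..1} (\<lambda>t. U (\<gamma> t) $ i $ j)" for i j
    proof (rule continuous_on_compose2[OF U])
      show "continuous_on {0..1} \<gamma>"
        unfolding \<gamma>_def by (intro continuous_intros)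
      show "\<gamma> ` {0..1} \<subseteq> - \<real>\<^sub>\<le>\<^sub>0"
        using \<gamma> by blast
    qed
    then have "continuous_on {0..1} (\<lambda>t. \<chi> i j. U (\<gamma> t) $ i $ j)"
      by (intro continuous_on_vec_lambda)
    then show "continuous_on {0..1} (\<lambda>t. U (\<gamma> t))"
      by simp
  qed
  then have "bounded ((\<lambda>t. norm (U (\<gamma> t))) ` {0..1})"
    by (intro compact_imp_bounded compact_continuous_image) auto
  then obtain K where K: "\<And>t. t \<in> {0..1} \<Longrightarrow> norm (U (\<gamma> t)) \<le> K"
    unfolding bounded_iff by fastforce
  have "Y (\<gamma> 1) = 0"
  \<comment> \<open>Along the segment the chain rule contributes \<open>z - of_real x\<close>;
    \<open>B\<close> bounds matrix multiplication and \<open>K\<close> bounds \<open>U\<close> on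
    the segment.\<close>
  proof (rule linear_ode_zero[where K = "norm (z - of_real x) * (B * K)"
        and Y' = "\<lambda>t. \<chi> i j. (z - of_real x) * (U (\<gamma> t) ** Y (\<gamma> t)) $ i $ j"])
    fix t :: real assume t: "t \<in> {0..1}"
    show "((\<lambda>t. Y (\<gamma> t)) has_vector_derivative
        (\<chi> i j. (z - of_real x) * (U (\<gamma> t) ** Y (\<gamma> t)) $ i $ j)) (at t)"
    proof (intro has_vector_derivative_vec)
      fix i j
      have "(\<gamma> has_vector_derivative (z - of_real x)) (at t)"
        unfolding \<gamma>_def by (auto intro!: derivative_eq_intros simp: has_vector_derivative_def scaleR_conv_of_real)
      from field_vector_diff_chain_at[OF this deriv[OF \<gamma>[OF t]], of i j]
      show "((\<lambda>t. Y (\<gamma> t) $ i $ j) has_vector_derivative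
          (\<chi> i j. (z - of_real x) * (U (\<gamma> t) ** Y (\<gamma> t)) $ i $ j) $ i $ j) (at t)"
        by (simp add: o_def mult.commute)
    qed
    have "norm (\<chi> i j. (z - of_real x) * (U (\<gamma> t) ** Y (\<gamma> t)) $ i $ j)
        = norm (z - of_real x) * norm (U (\<gamma> t) ** Y (\<gamma> t))"
      unfolding norm_vec_def L2_set_def
      by (simp add: norm_mult power_mult_distrib sum_distrib_left[symmetric] real_sqrt_mult sum_nonneg)
    also have "\<dots> \<le> norm (z - of_real x) * (B * K * norm (Y (\<gamma> t)))"
      using B(2)[of "U (\<gamma> t)" "Y (\<gamma> t)"] K[OF t] B(1)
      by (intro mult_left_mono) (auto intro: order_trans[OF _ mult_right_mono[OF mult_left_mono]])
    finally show "norm (\<chi> i j. (z - of_real x) * (U (\<gamma> t) ** Y (\<gamma> t)) $ i $ j)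
        \<le> norm (z - of_real x) * (B * K) * norm (Y (\<gamma> t))"
      by (simp add: mult_ac)
  qed (simp add: \<gamma>_def x)
  then show ?thesis
    by (simp add: \<gamma>_def)
qed

lemma matrix_mult_has_field_derivative:
  fixes A B :: "complex \<Rightarrow> complex ^ 'n ^ 'n"
  assumes "\<And>i j. ((\<lambda>w. A w $ i $ j) has_field_derivative A' $ i $ j) (at z)"
    and "\<And>i j. ((\<lambda>w. B w $ i $ j) has_field_derivative B' $ i $ j) (at z)"
  shows "((\<lambda>w. (A w ** B w) $ i $ j) has_field_derivative (A' ** B z + A z ** B') $ i $ j) (at z)"
proof -
  have "((\<lambda>w. \<Sum>k\<in>UNIV. A w $ i $ k * B w $ k $ j) has_field_derivative
      (\<Sum>k\<in>UNIV. A' $ i $ k * B z $ k $ j + B' $ k $ j * A z $ i $ k)) (at z)"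
    by (intro DERIV_sum DERIV_mult assms)
  then show ?thesis
    by (simp add: matrix_matrix_mult_def sum.distrib mult.commute)
qed

section \<open>Explicit and diagonal matrices\<close>

lemma mat_mult_nth: "(mat c ** A) $ i $ j = c * A $ i $ j"
  for A :: "'a::semiring_1 ^ 'm ^ 'n"
  by (simp add: matrix_matrix_mult_def mat_def if_distrib[of "\<lambda>x. x * _"] cong: if_cong)

lemma mat4_mult:
  "mat4 [[a11, a12, a13, a14], [a21, a22, a23, a24], [a31, a32, a33, a34], [a41, a42, a43, a44]] **
   mat4 [[b11, b12, b13, b14], [b21, b22, b23, b24], [b31, b32, b33, b34], [b41, b42, b43, b44]] =
   mat4 [[a11*b11 + a12*b21 + a13*b31 + a14*b41, a11*b12 + a12*b22 + a13*b32 + a14*b42,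
          a11*b13 + a12*b23 + a13*b33 + a14*b43, a11*b14 + a12*b24 + a13*b34 + a14*b44],
         [a21*b11 + a22*b21 + a23*b31 + a24*b41, a21*b12 + a22*b22 + a23*b32 + a24*b42,
          a21*b13 + a22*b23 + a23*b33 + a24*b43, a21*b14 + a22*b24 + a23*b34 + a24*b44],
         [a31*b11 + a32*b21 + a33*b31 + a34*b41, a31*b12 + a32*b22 + a33*b32 + a34*b42,
          a31*b13 + a32*b23 + a33*b33 + a34*b43, a31*b14 + a32*b24 + a33*b34 + a34*b44],
         [a41*b11 + a42*b21 + a43*b31 + a44*b41, a41*b12 + a42*b22 + a43*b32 + a44*b42,
          a41*b13 + a42*b23 + a43*b33 + a44*b43, a41*b14 + a42*b24 + a43*b34 + a44*b44]]"
  by (simp add: vec_eq_iff forall_4 matrix_matrix_mult_def sum_4 mat4_def)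

lemma mat4_add:
  "mat4 [[a11, a12, a13, a14], [a21, a22, a23, a24], [a31, a32, a33, a34], [a41, a42, a43, a44]] +
   mat4 [[b11, b12, b13, b14], [b21, b22, b23, b24], [b31, b32, b33, b34], [b41, b42, b43, b44]] =
   mat4 [[a11 + b11, a12 + b12, a13 + b13, a14 + b14], [a21 + b21, a22 + b22, a23 + b23, a24 + b24],
         [a31 + b31, a32 + b32, a33 + b33, a34 + b34], [a41 + b41, a42 + b42, a43 + b43, a44 + b44]]"
  by (simp add: vec_eq_iff forall_4 mat4_def)

lemma mat4_cmult:
  "mat c ** mat4 [[a11, a12, a13, a14], [a21, a22, a23, a24], [a31, a32, a33, a34], [a41, a42, a43, a44]] =
   mat4 [[c * a11, c * a12, c * a13, c * a14], [c * a21, c * a22, c * a23, c * a24],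
         [c * a31, c * a32, c * a33, c * a34], [c * a41, c * a42, c * a43, c * a44]]"
  by (simp add: vec_eq_iff forall_4 mat_mult_nth mat4_def)

lemma mat_eq_mat4: "mat c = mat4 [[c, 0, 0, 0], [0, c, 0, 0], [0, 0, c, 0], [0, 0, 0, c]]"
  by (simp add: vec_eq_iff forall_4 mat_def mat4_def)

definition diag_mat :: "complex ^ 'n \<Rightarrow> complex ^ 'n ^ 'n" where
  "diag_mat v = (\<chi> i j. if i = j then v $ i else 0)"

lemma diag_mat_mult_nth: "(diag_mat v ** A) $ i $ j = v $ i * A $ i $ j"
  by (simp add: diag_mat_def matrix_matrix_mult_def if_distrib[of "\<lambda>x. x * _"] cong: if_cong)

lemma mult_diag_mat_nth: "(A ** diag_mat v) $ i $ j = A $ i $ j * v $ j"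
  by (simp add: diag_mat_def matrix_matrix_mult_def if_distrib[of "\<lambda>x. _ * x"] cong: if_cong)

lemma diag_mat_mult_diag_mat: "diag_mat v ** diag_mat w = diag_mat (\<chi> i. v $ i * w $ i)"
  by (simp add: vec_eq_iff diag_mat_mult_nth) (simp add: diag_mat_def)

lemma diag_mat_1: "diag_mat (\<chi> i. 1) = mat 1"
  by (simp add: diag_mat_def mat_def vec_eq_iff)

lemma diag4_eq_diag_mat: "diag4 a b c d = diag_mat (vector [a, b, c, d])"
  by (simp add: vec_eq_iff forall_4 diag4_def mat4_def diag_mat_def)

lemma tendsto_matrix_mult:
  fixes f g :: "'a \<Rightarrow> complex ^ 'n ^ 'n"
  assumes "(f \<longlongrightarrow> a) F" "(g \<longlongrightarrow> b) F"
  shows "((\<lambda>x. f x ** g x) \<longlongrightarrow> a ** b) F"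
  using bilinear_matrix_mult assms unfolding bilinear_conv_bounded_bilinear
  by (rule bounded_bilinear.tendsto)

lemma tendsto_det:
  fixes f :: "'a \<Rightarrow> complex ^ 'n ^ 'n"
  assumes "(f \<longlongrightarrow> a) F"
  shows "((\<lambda>x. det (f x)) \<longlongrightarrow> det a) F"
  unfolding det_def by (intro tendsto_sum tendsto_mult tendsto_const tendsto_prod tendsto_vec_nth assms)

section \<open>The model solution in the sector\<close>

abbreviation sector_at_infinity :: "complex filter" where
  "sector_at_infinity \<equiv> inf at_infinity (principal tac_sector)"

lemma filterlim_ray_sector:
  assumes "- pi / 12 < \<phi>" "\<phi> < 7 * pi / 12"
  shows "filterlim (\<lambda>r. of_real r * cis \<phi>) sector_at_infinity at_top"
  unfolding filterlim_inf
proof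
  have "filterlim (\<lambda>r. norm (of_real r * cis \<phi>)) at_top at_top"
    by (simp add: norm_mult filterlim_abs_real)
  then show "filterlim (\<lambda>r. of_real r * cis \<phi>) at_infinity at_top"
    by (rule filterlim_norm_at_top_imp_at_infinity)
  have "Arg (cis \<phi>) = \<phi>"
    using assms pi_gt_zero by (intro Arg_cis) auto
  moreover have "\<forall>\<^sub>F r in at_top. Arg (of_real r * cis \<phi>) = Arg (cis \<phi>)"
    using eventually_gt_at_top[of 0] by eventually_elim (rule Arg_times_of_real)
  ultimately have "\<forall>\<^sub>F r in at_top. Arg (of_real r * cis \<phi>) = \<phi>"
    by simp
  then show "filterlim (\<lambda>r. of_real r * cis \<phi>) (principal tac_sector) at_top"
    unfolding filterlim_principal by eventually_elim (use assms in \<open>simp add: tac_sector_def\<close>)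
qed

lemma eventually_sector_norm_ge_1: "\<forall>\<^sub>F z :: complex in sector_at_infinity. norm z \<ge> 1"
  by (rule filter_leD[OF inf_le1]) (auto simp: eventually_at_infinity)

lemma inverse_square_bigo_inverse: "(\<lambda>z::complex. 1 / z^2) \<in> O[sector_at_infinity](\<lambda>z. 1 / z)"
proof (rule landau_o.big_mono)
  show "\<forall>\<^sub>F z :: complex in sector_at_infinity. norm (1 / z^2) \<le> norm (1 / z)"
    using eventually_sector_norm_ge_1
  proof eventually_elim
    case (elim z)
    then have "norm z * 1 \<le> norm z * norm z" by (intro mult_left_mono) auto
    with elim show ?case
      by (simp add: norm_divide norm_mult power2_eq_square divide_simps)
  qed
qed

definition tac_D :: "complex \<Rightarrow> complex ^ 4" where
  "tac_D z = vector [neg_powr z (- 1 / 4), z powr (- 1 / 4), neg_powr z (1 / 4), z powr (1 / 4)]"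

definition tac_exponent :: "real \<Rightarrow> real \<Rightarrow> complex \<Rightarrow> complex ^ 4" where
  "tac_exponent s \<tau> z = vector
    [- tac_theta1 s z + of_real \<tau> * z, - tac_theta2 s z - of_real \<tau> * z,
     tac_theta1 s z + of_real \<tau> * z, tac_theta2 s z - of_real \<tau> * z]"

lemma tac_model_eq:
  "tac_model s \<tau> z = diag_mat (tac_D z) ** tac_A ** diag_mat (\<chi> i. exp (tac_exponent s \<tau> z $ i))"
proof -
  have "(\<chi> i. exp (tac_exponent s \<tau> z $ i)) = vector
     [exp (- tac_theta1 s z + of_real \<tau> * z), exp (- tac_theta2 s z - of_real \<tau> * z),
      exp (tac_theta1 s z + of_real \<tau> * z), exp (tac_theta2 s z - of_real \<tau> * z)]"
    by (simp add: vec_eq_iff forall_4 tac_exponent_def)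
  then show ?thesis
    by (simp add: tac_model_def diag4_eq_diag_mat tac_D_def)
qed

text \<open>The conjugate transpose of the unitary matrix \<open>tac_A\<close>.\<close>

definition tac_A_inv :: "complex ^ 4 ^ 4" where
  "tac_A_inv = mat (1 / of_real (sqrt 2)) ** mat4
      [[1, 0, \<i>, 0], [0, 1, 0, - \<i>], [\<i>, 0, 1, 0], [0, - \<i>, 0, 1]]"

lemma tac_A_inv: "tac_A ** tac_A_inv = mat 1" "tac_A_inv ** tac_A = mat 1"
proof -
  have "complex_of_real (sqrt 2) * complex_of_real (sqrt 2) = 2"
    by (simp flip: of_real_mult)
  then have "1 / complex_of_real (sqrt 2) * (1 / complex_of_real (sqrt 2)) = 1 / 2"
    by simp
  then show "tac_A ** tac_A_inv = mat 1" "tac_A_inv ** tac_A = mat 1"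
    unfolding tac_A_def tac_A_inv_def mat4_cmult mat4_mult mat_eq_mat4[of 1]
    by (simp_all add: mult_ac)
qed

lemma norm_neg_powr: "norm (neg_powr z p) = norm z powr p"
  by (simp add: neg_powr_def norm_mult norm_powr_real_powr')

lemma norm_tac_D:
  assumes "z \<noteq> 0"
  shows "norm (tac_D z $ i) = norm z powr (if i = 1 \<or> i = 2 then - 1 / 4 else 1 / 4)"
proof -
  have "norm (z powr (1 / 4)) = norm z powr (1 / 4)" "norm (z powr (- 1 / 4)) = norm z powr (- 1 / 4)"
    using norm_powr_real_powr'[of "of_real (1 / 4)" z] norm_powr_real_powr'[of "of_real (- 1 / 4)" z]
    by simp_all
  then show ?thesis
    using exhaust_4[of i] by (auto simp: tac_D_def norm_neg_powr)
qed

text \<open>The entries of \<open>tac_D z\<close> have modulus \<open>norm z\<close> to the power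
  \<open>1 / 4\<close> or \<open>- 1 / 4\<close>, so conjugation costs at most the power
  \<open>1 / 2\<close>, and a term of order \<open>1 / z\<close> keeps decay of power
  \<open>- 1 / 2\<close>.\<close>

lemma conjugated_tendsto_0:
  assumes "\<And>i j. (\<lambda>z. A z $ i $ j) \<in> O[sector_at_infinity](\<lambda>z. 1 / z)"
  shows "((\<lambda>z. tac_A_inv ** (diag_mat (\<chi> i. inverse (tac_D z $ i)) ** A z ** diag_mat (tac_D z)) ** tac_A)
           \<longlongrightarrow> 0) sector_at_infinity"
proof -
  have "((\<lambda>z. inverse (tac_D z $ i) * A z $ i $ j * tac_D z $ j) \<longlongrightarrow> 0) sector_at_infinity" for i j
  proof -
    obtain C where C: "\<forall>\<^sub>F z in sector_at_infinity. norm (A z $ i $ j) \<le> C * norm (1 / z)"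
      using assms[of i j] by (auto elim: landau_o.bigE)
    note ge1 = eventually_sector_norm_ge_1
    show ?thesis
    proof (rule Lim_null_comparison)
      show "\<forall>\<^sub>F z in sector_at_infinity.
          norm (inverse (tac_D z $ i) * A z $ i $ j * tac_D z $ j) \<le> C * (norm z powr (- 1 / 2))"
        using C ge1
      proof eventually_elim
        case (elim z)
        then have "z \<noteq> 0" by auto
        have "norm (inverse (tac_D z $ i) * A z $ i $ j * tac_D z $ j)
            = norm (A z $ i $ j) * (norm (tac_D z $ j) / norm (tac_D z $ i))"
          by (simp add: norm_mult norm_inverse norm_divide field_simps)
        also have "\<dots> \<le> (C * norm (1 / z)) * (norm z powr (1 / 2))"
        proof (rule mult_mono[OF elim(1)])
          show "norm (tac_D z $ j) / norm (tac_D z $ i) \<le> norm z powr (1 / 2)"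
            unfolding norm_tac_D[OF \<open>z \<noteq> 0\<close>] powr_diff[symmetric]
            using elim(2) by (intro powr_mono) auto
          show "0 \<le> C * norm (1 / z)"
            using elim(1) norm_ge_zero order_trans by blast
        qed auto
        also have "\<dots> = C * (norm z powr (- 1 + 1 / 2))"
        proof -
          have "norm (1 / z) = norm z powr - 1"
            using \<open>z \<noteq> 0\<close> by (simp add: norm_divide powr_minus_divide)
          then show ?thesis
            by (simp only: powr_add mult.assoc)
        qed
        finally show ?case by simp
      qed
      have "((\<lambda>z::complex. norm z powr (- 1 / 2)) \<longlongrightarrow> 0) sector_at_infinity"
        by (rule tendsto_mono[OF inf_le1])
           (rule filterlim_compose[OF _ filterlim_norm_at_top], real_asymp)
      from tendsto_mult_left[OF this, of C]
      show "((\<lambda>z. C * (norm z powr (- 1 / 2))) \<longlongrightarrow> 0) sector_at_infinity"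
        by simp
    qed
  qed
  then have "((\<lambda>z. diag_mat (\<chi> i. inverse (tac_D z $ i)) ** A z ** diag_mat (tac_D z)) \<longlongrightarrow> 0) sector_at_infinity"
    by (intro vec_tendstoI) (simp add: diag_mat_mult_nth mult_diag_mat_nth)
  from tendsto_matrix_mult[OF tendsto_matrix_mult[OF tendsto_const this] tendsto_const]
  show ?thesis by (simp add: matrix_matrix_mult_def vec_eq_iff zero_vec_def)
qed

text \<open>The error factor is moved from the left of the model to the position just before the
  exponentials. Two solutions can then be compared after cancelling the common factor
  \<open>diag_mat (tac_D z) ** tac_A\<close>.\<close>

lemma is_tac_M_factorization:
  assumes "is_tac_M \<nu> q s \<tau> M"
  obtains A where "(A \<longlongrightarrow> 0) sector_at_infinity"
    and "\<forall>\<^sub>F z in sector_at_infinity. M z = diag_mat (tac_D z) ** tac_A ** (mat 1 + A z)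
           ** diag_mat (\<chi> i. exp (tac_exponent s \<tau> z $ i))"
proof -
  obtain M1 E where E: "\<And>i j. (\<lambda>z. E z $ i $ j) \<in> O[sector_at_infinity](\<lambda>z. 1 / z^2)"
    and M: "\<forall>\<^sub>F z in sector_at_infinity. M z = (mat 1 + mat (1 / z) ** M1 + E z) ** tac_model s \<tau> z"
    using assms unfolding is_tac_M_def by blast
  define B where "B z = mat (1 / z) ** M1 + E z" for z
  define A where "A z = tac_A_inv **
      (diag_mat (\<chi> i. inverse (tac_D z $ i)) ** B z ** diag_mat (tac_D z)) ** tac_A" for z
  note ge1 = eventually_sector_norm_ge_1
  have "(\<lambda>z. E z $ i $ j) \<in> O[sector_at_infinity](\<lambda>z. 1 / z)" for i j
    by (rule landau_o.big_trans[OF E inverse_square_bigo_inverse])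
  moreover have "(\<lambda>z. 1 / z * M1 $ i $ j) \<in> O[sector_at_infinity](\<lambda>z. 1 / z)" for i j
    by (rule bigoI[where c = "norm (M1 $ i $ j)"]) (simp add: norm_divide)
  ultimately have "(\<lambda>z. B z $ i $ j) \<in> O[sector_at_infinity](\<lambda>z. 1 / z)" for i j
    unfolding B_def vector_add_component mat_mult_nth by (intro sum_in_bigo(1))
  from conjugated_tendsto_0[OF this] have "(A \<longlongrightarrow> 0) sector_at_infinity"
    by (simp add: A_def[abs_def])
  moreover have "\<forall>\<^sub>F z in sector_at_infinity. M z = diag_mat (tac_D z) ** tac_A ** (mat 1 + A z)
           ** diag_mat (\<chi> i. exp (tac_exponent s \<tau> z $ i))"
    using M ge1
  proof eventually_elim
    case (elim z)
    then have "z \<noteq> 0" by auto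
    have "tac_D z $ i \<noteq> 0" for i
      using norm_tac_D[OF \<open>z \<noteq> 0\<close>, of i] \<open>z \<noteq> 0\<close> by (metis norm_eq_zero powr_eq_0_iff)
    then have D: "diag_mat (tac_D z) ** diag_mat (\<chi> i. inverse (tac_D z $ i)) = mat 1"
      by (simp add: diag_mat_mult_diag_mat flip: diag_mat_1)
    have "diag_mat (tac_D z) ** tac_A ** A z = diag_mat (tac_D z) ** (tac_A ** tac_A_inv) **
        diag_mat (\<chi> i. inverse (tac_D z $ i)) ** B z ** diag_mat (tac_D z) ** tac_A"
      by (simp add: A_def matrix_mul_assoc)
    also have "\<dots> = B z ** diag_mat (tac_D z) ** tac_A"
      by (simp add: tac_A_inv D)
    finally show ?case
      unfolding elim(1) tac_model_eq B_def
      by (simp add: matrix_mul_assoc matrix_add_ldistrib matrix_mult_add_rdistrib add.assoc)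
  qed
  ultimately show ?thesis using that by blast
qed

section \<open>Exponents along rays\<close>

lemma powr_ray:
  assumes "r > 0" "- pi < \<phi>" "\<phi> \<le> pi"
  shows "(of_real r * cis \<phi>) powr (of_real p) = of_real (r powr p) * cis (p * \<phi>)"
proof -
  have exp: "of_real r * cis \<phi> = exp (Complex (ln r) \<phi>)"
    using assms by (simp add: exp_eq_polar)
  have "Ln (of_real r * cis \<phi>) = Complex (ln r) \<phi>"
    unfolding exp using assms by (intro Ln_exp) auto
  then have "(of_real r * cis \<phi>) powr (of_real p) = exp (of_real p * Complex (ln r) \<phi>)"
    using assms by (simp add: powr_def)
  also have "\<dots> = of_real (r powr p) * cis (p * \<phi>)"
    using assms by (simp add: exp_eq_polar powr_def exp_of_real)
  finally show ?thesis .
qed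

text \<open>The constant prefactor in \<open>neg_powr\<close> shifts the argument of
  \<open>z\<close> by \<open>- pi\<close>.\<close>

lemma neg_powr_ray:
  assumes "r > 0" "- pi < \<phi>" "\<phi> \<le> pi"
  shows "neg_powr (of_real r * cis \<phi>) p = of_real (r powr p) * cis (p * (\<phi> - pi))"
proof -
  have "exp (- \<i> * of_real p * of_real pi) = cis (- p * pi)"
    by (simp add: cis_conv_exp mult_ac)
  then show ?thesis
    unfolding neg_powr_def powr_ray[OF assms]
    by (simp add: cis_mult mult_ac right_diff_distrib)
qed

text \<open>Only the leading coefficients are made explicit, since their order decides which
  exponential dominates; \<open>b\<close> and \<open>e\<close> collect the contributions of
  \<open>s\<close> and \<open>\<tau>\<close>.\<close>

lemma Re_tac_exponent_ray:
  assumes "- pi < \<phi>" "\<phi> \<le> pi"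
  obtains b e where "\<And>r. r > 0 \<Longrightarrow> Re (tac_exponent s \<tau> (of_real r * cis \<phi>) $ i) =
      2 / 3 * vector [sin (3 / 2 * \<phi>), - cos (3 / 2 * \<phi>), - sin (3 / 2 * \<phi>), cos (3 / 2 * \<phi>)] $ (i :: 4)
        * r powr (3 / 2) + b * r powr (1 / 2) + e * r"
proof -
  let ?b = "vector [- 2 * s * cos (1 / 2 * (\<phi> - pi)), - 2 * s * cos (1 / 2 * \<phi>),
      2 * s * cos (1 / 2 * (\<phi> - pi)), 2 * s * cos (1 / 2 * \<phi>)] :: real ^ 4"
  let ?e = "vector [\<tau> * cos \<phi>, - \<tau> * cos \<phi>, \<tau> * cos \<phi>, - \<tau> * cos \<phi>] :: real ^ 4"
  have cos: "cos (3 / 2 * (\<phi> - pi)) = - sin (3 / 2 * \<phi>)"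
  proof -
    have "cos (3 / 2 * (\<phi> - pi)) = cos (3 / 2 * \<phi> + pi / 2 - 2 * pi)"
      by (simp add: field_simps)
    also have "\<dots> = - sin (3 / 2 * \<phi>)"
      by (simp only: cos_diff cos_add) simp
    finally show ?thesis .
  qed
  have "Re (tac_exponent s \<tau> (of_real r * cis \<phi>) $ i) =
      2 / 3 * vector [sin (3 / 2 * \<phi>), - cos (3 / 2 * \<phi>), - sin (3 / 2 * \<phi>), cos (3 / 2 * \<phi>)] $ i
        * r powr (3 / 2) + ?b $ i * r powr (1 / 2) + ?e $ i * r" if r: "r > 0" for r
  proof -
    have pw: "(of_real r * cis \<phi>) powr (3 / 2) = of_real (r powr (3 / 2)) * cis (3 / 2 * \<phi>)"
      "(of_real r * cis \<phi>) powr (1 / 2) = of_real (r powr (1 / 2)) * cis (1 / 2 * \<phi>)"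
      using powr_ray[OF r assms, of "3 / 2"] powr_ray[OF r assms, of "1 / 2"] by simp_all
    have th1: "Re (tac_theta1 s (of_real r * cis \<phi>)) =
        - 2 / 3 * sin (3 / 2 * \<phi>) * r powr (3 / 2) + 2 * s * cos (1 / 2 * (\<phi> - pi)) * r powr (1 / 2)"
      unfolding tac_theta1_def neg_powr_ray[OF r assms] using cos by simp
    have th2: "Re (tac_theta2 s (of_real r * cis \<phi>)) =
        2 / 3 * cos (3 / 2 * \<phi>) * r powr (3 / 2) + 2 * s * cos (1 / 2 * \<phi>) * r powr (1 / 2)"
      unfolding tac_theta2_def pw by simp
    show ?thesis
      using exhaust_4[of i] th1 th2 by (auto simp: tac_exponent_def algebra_simps)
  qed
  then show ?thesis using that by blast
qed

text \<open>The power \<open>3 / 2\<close> of \<open>r\<close> outweighs the terms in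
  \<open>r\<close> and its square root, so a strict order of the leading coefficients settles the
  comparison.\<close>

lemma eventually_Re_tac_exponent_le:
  fixes i j :: 4
  assumes \<phi>: "- pi < \<phi>" "\<phi> \<le> pi"
    and less: "(vector [sin (3 / 2 * \<phi>), - cos (3 / 2 * \<phi>), - sin (3 / 2 * \<phi>), cos (3 / 2 * \<phi>)] :: real ^ 4) $ j
        < vector [sin (3 / 2 * \<phi>), - cos (3 / 2 * \<phi>), - sin (3 / 2 * \<phi>), cos (3 / 2 * \<phi>)] $ i"
  shows "\<forall>\<^sub>F r in at_top. Re (tac_exponent s \<tau> (of_real r * cis \<phi>) $ j)
          \<le> Re (tac_exponent s \<tau> (of_real r * cis \<phi>) $ i)"
proof -
  define a :: "real ^ 4" where
    "a = vector [sin (3 / 2 * \<phi>), - cos (3 / 2 * \<phi>), - sin (3 / 2 * \<phi>), cos (3 / 2 * \<phi>)]"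
  obtain b e where i: "\<And>r. r > 0 \<Longrightarrow> Re (tac_exponent s \<tau> (of_real r * cis \<phi>) $ i) =
      2 / 3 * a $ i * r powr (3 / 2) + b * r powr (1 / 2) + e * r"
    unfolding a_def using Re_tac_exponent_ray[OF \<phi>] by blast
  obtain b' e' where j: "\<And>r. r > 0 \<Longrightarrow> Re (tac_exponent s \<tau> (of_real r * cis \<phi>) $ j) =
      2 / 3 * a $ j * r powr (3 / 2) + b' * r powr (1 / 2) + e' * r"
    unfolding a_def using Re_tac_exponent_ray[OF \<phi>] by blast
  define k where "k = 2 / 3 * a $ i - 2 / 3 * a $ j"
  have "k > 0"
    using less by (simp add: k_def a_def)
  \<comment> \<open>The difference of the two exponents, divided by
    \<open>r powr (3 / 2)\<close>.\<close>
  have "((\<lambda>r. k + (b - b') * r powr - 1 + (e - e') * r powr (- 1 / 2)) \<longlongrightarrow> k + (b - b') * 0 + (e - e') * 0) at_top"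
    by (intro tendsto_intros; real_asymp)
  then have "\<forall>\<^sub>F r in at_top. 0 < k + (b - b') * r powr - 1 + (e - e') * r powr (- 1 / 2)"
    by (rule order_tendstoD(1)) (use \<open>k > 0\<close> in simp)
  then show ?thesis
    using eventually_gt_at_top[of 0]
  proof eventually_elim
    case (elim r)
    have "0 \<le> r powr (3 / 2) * (k + (b - b') * r powr - 1 + (e - e') * r powr (- 1 / 2))"
      using elim by simp
    also have "\<dots> = k * r powr (3 / 2) + (b - b') * (r powr (3 / 2) * r powr - 1)
        + (e - e') * (r powr (3 / 2) * r powr (- 1 / 2))"
      by (simp only: ring_distribs mult_ac)
    also have "\<dots> = k * r powr (3 / 2) + (b - b') * r powr (1 / 2) + (e - e') * r"
      using elim powr_add[of r "3 / 2" "- 1"] powr_add[of r "3 / 2" "- 1 / 2"] by simp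
    finally show ?case
      unfolding i[OF elim(2)] j[OF elim(2)] k_def left_diff_distrib by linarith
  qed
qed

text \<open>On the ray with \<open>3\<phi>/2 = -\<pi>/16\<close> the exponents are ordered \<open>\<lambda>\<^sub>2 < \<lambda>\<^sub>1 < \<lambda>\<^sub>3 < \<lambda>\<^sub>4\<close>,
  and on the ray with \<open>3\<phi>/2 = 13\<pi>/16\<close> they are ordered in the opposite way.\<close>

lemma dominating_ray:
  fixes i j :: 4
  assumes "i \<noteq> j"
  obtains \<phi> where "- pi / 12 < \<phi>" "\<phi> < 7 * pi / 12"
    and "\<forall>\<^sub>F r in at_top. Re (tac_exponent s \<tau> (of_real r * cis \<phi>) $ j)
          \<le> Re (tac_exponent s \<tau> (of_real r * cis \<phi>) $ i)"
proof -
  let ?v = "\<lambda>\<phi>. vector [sin (3 / 2 * \<phi>), - cos (3 / 2 * \<phi>), - sin (3 / 2 * \<phi>), cos (3 / 2 * \<phi>)] :: real ^ 4"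
  \<comment> \<open>Applied to \<open>pi / 16\<close> and \<open>3 * pi / 16\<close>, this orders
    the sines and cosines with their signs strictly on each ray.\<close>
  have less: "0 < sin x \<and> sin x < cos x" if "0 < x" "x < pi / 4" for x :: real
  proof -
    have "sin x < sin (pi / 2 - x)"
      using that by (intro sin_monotone_2pi) auto
    then show ?thesis
      using that by (auto simp: sin_diff intro!: sin_gt_zero)
  qed
  have bounds: "- pi / 12 < - pi / 24" "- pi / 24 < 7 * pi / 12" "- pi < - pi / 24" "- pi / 24 \<le> pi"
    "- pi / 12 < 13 * pi / 24" "13 * pi / 24 < 7 * pi / 12" "- pi < 13 * pi / 24" "13 * pi / 24 \<le> pi"
    using pi_gt_zero by linarith+
  have arg1: "3 / 2 * (- pi / 24) = - (pi / 16)" and arg2: "3 / 2 * (13 * pi / 24) = pi - 3 * pi / 16"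
    by simp_all
  have "?v (- pi / 24) $ j < ?v (- pi / 24) $ i \<or> ?v (13 * pi / 24) $ j < ?v (13 * pi / 24) $ i"
    unfolding arg1 arg2 sin_minus cos_minus sin_pi_minus cos_pi_minus
    using less[of "pi / 16"] less[of "3 * pi / 16"] assms exhaust_4[of i] exhaust_4[of j]
    by (elim disjE; simp)
  then show ?thesis
  proof
    assume "?v (- pi / 24) $ j < ?v (- pi / 24) $ i"
    from eventually_Re_tac_exponent_le[OF bounds(3,4) this] show ?thesis
      by (intro that[OF bounds(1,2)])
  next
    assume "?v (13 * pi / 24) $ j < ?v (13 * pi / 24) $ i"
    from eventually_Re_tac_exponent_le[OF bounds(7,8) this] show ?thesis
      by (intro that[OF bounds(5,6)])
  qed
qed

section \<open>Uniqueness of the solution with the prescribed expansion\<close>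

lemma tac_U_continuous_on: "continuous_on (- \<real>\<^sub>\<le>\<^sub>0) (\<lambda>z. tac_U \<nu> q s \<tau> z $ i $ j)"
proof -
  have "z \<noteq> 0" if "z \<in> - \<real>\<^sub>\<le>\<^sub>0" for z :: complex
    using that by auto
  then show ?thesis
    using exhaust_4[of i] exhaust_4[of j]
    by (elim disjE; simp add: tac_U_def mat4_def Let_def; intro continuous_intros; simp)
qed

lemma is_tac_M_unique:
  assumes M: "is_tac_M \<nu> q s \<tau> M" and N: "is_tac_M \<nu> q s \<tau> N" and z: "z \<notin> \<real>\<^sub>\<le>\<^sub>0"
  shows "N z = M z"
proof -
  define \<Lambda> where "\<Lambda> z = diag_mat (\<chi> i. exp (tac_exponent s \<tau> z $ i))" for z
  define \<Lambda>' where "\<Lambda>' z = diag_mat (\<chi> i. exp (- tac_exponent s \<tau> z $ i))" for z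
  define W where "W z = diag_mat (tac_D z) ** tac_A" for z
  define W' where "W' z = tac_A_inv ** diag_mat (\<chi> i. inverse (tac_D z $ i))" for z
  obtain A where A: "(A \<longlongrightarrow> 0) sector_at_infinity"
    and MA: "\<forall>\<^sub>F z in sector_at_infinity. M z = W z ** (mat 1 + A z) ** \<Lambda> z"
    unfolding W_def \<Lambda>_def by (rule is_tac_M_factorization[OF M])
  obtain B where B: "(B \<longlongrightarrow> 0) sector_at_infinity"
    and NB: "\<forall>\<^sub>F z in sector_at_infinity. N z = W z ** (mat 1 + B z) ** \<Lambda> z"
    unfolding W_def \<Lambda>_def by (rule is_tac_M_factorization[OF N])
  have \<Lambda>: "\<Lambda> z ** \<Lambda>' z = mat 1" "\<Lambda>' z ** \<Lambda> z = mat 1" for z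
    by (simp_all add: \<Lambda>_def \<Lambda>'_def diag_mat_mult_diag_mat flip: diag_mat_1 exp_add)
  have W: "W' z ** W z = mat 1" "W z ** W' z = mat 1" if "z \<noteq> 0" for z
  proof -
    have "tac_D z $ i \<noteq> 0" for i
      using norm_tac_D[OF that, of i] that by (metis norm_eq_zero powr_eq_0_iff)
    then have D: "diag_mat (\<chi> i. inverse (tac_D z $ i)) ** diag_mat (tac_D z) = mat 1"
      "diag_mat (tac_D z) ** diag_mat (\<chi> i. inverse (tac_D z $ i)) = mat 1"
      by (simp_all add: diag_mat_mult_diag_mat flip: diag_mat_1)
    have "W' z ** W z = tac_A_inv ** (diag_mat (\<chi> i. inverse (tac_D z $ i)) ** diag_mat (tac_D z)) ** tac_A"
      by (simp add: W_def W'_def matrix_mul_assoc)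
    then show "W' z ** W z = mat 1"
      by (simp add: D tac_A_inv)
    have "W z ** W' z = diag_mat (tac_D z) ** (tac_A ** tac_A_inv) ** diag_mat (\<chi> i. inverse (tac_D z $ i))"
      by (simp add: W_def W'_def matrix_mul_assoc)
    then show "W z ** W' z = mat 1"
      by (simp add: D tac_A_inv)
  qed
  note ge1 = eventually_sector_norm_ge_1

  \<comment> \<open>The determinant of \<open>mat 1 + A z\<close> tends to 1, so all factors of
    \<open>M\<close> are invertible at some large positive \<open>x\<close>.\<close>
  have "((\<lambda>z. det (mat 1 + A z)) \<longlongrightarrow> det (mat 1 + 0 :: complex ^ 4 ^ 4)) sector_at_infinity"
    by (intro tendsto_det tendsto_add tendsto_const A)
  then have det: "\<forall>\<^sub>F z in sector_at_infinity. det (mat 1 + A z) \<noteq> 0"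
    by (rule tendsto_imp_eventually_ne) simp
  have "filterlim (\<lambda>r. of_real r * cis 0) sector_at_infinity at_top"
    by (rule filterlim_ray_sector) auto
  then have "filterlim complex_of_real sector_at_infinity at_top"
    by simp
  from eventually_compose_filterlim[OF eventually_conj[OF MA eventually_conj[OF det ge1]] this]
  have "\<forall>\<^sub>F r in at_top. M (of_real r) = W (of_real r) ** (mat 1 + A (of_real r)) ** \<Lambda> (of_real r)
      \<and> det (mat 1 + A (of_real r)) \<noteq> 0 \<and> norm (complex_of_real r) \<ge> 1" .
  from eventually_happens'[OF _ eventually_conj[OF this eventually_gt_at_top[of 0]]]
  obtain x where x: "x > 0" "det (mat 1 + A (of_real x)) \<noteq> 0"
      "M (of_real x) = W (of_real x) ** (mat 1 + A (of_real x)) ** \<Lambda> (of_real x)"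
    by auto
  have "invertible (W (of_real x))" "invertible (\<Lambda> (of_real x))"
    using W[of "of_real x"] \<Lambda>[of "of_real x"] x(1) unfolding invertible_def by auto
  moreover have "invertible (mat 1 + A (of_real x))"
    using x(2) by (simp add: invertible_det_nz)
  ultimately have "invertible (M (of_real x))"
    unfolding x(3) by (intro invertible_mult)
  then obtain M' where M': "M (of_real x) ** M' = mat 1"
    unfolding invertible_def by blast
  \<comment> \<open>\<open>C\<close> makes \<open>N\<close> and \<open>M ** C\<close> agree at
    \<open>x\<close>; both solve the same linear system, hence agree on the slit plane.\<close>
  define C where "C = M' ** N (of_real x)"
  have NMC: "N z = M z ** C" if "z \<notin> \<real>\<^sub>\<le>\<^sub>0" for z
  proof -
    have "N z - M z ** C = 0"
    proof (rule matrix_ode_zero_on_slit_plane[OF _ tac_U_continuous_on[of \<nu> q s \<tau>] x(1) _ that])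
      fix z :: complex and i j assume z: "z \<notin> \<real>\<^sub>\<le>\<^sub>0"
      have dM: "((\<lambda>w. M w $ i $ j) has_field_derivative (tac_U \<nu> q s \<tau> z ** M z) $ i $ j) (at z)"
        and dN: "((\<lambda>w. N w $ i $ j) has_field_derivative (tac_U \<nu> q s \<tau> z ** N z) $ i $ j) (at z)" for i j
        using M N z unfolding is_tac_M_def by blast+
      have "((\<lambda>w. (M w ** C) $ i $ j) has_field_derivative
          ((tac_U \<nu> q s \<tau> z ** M z) ** C + M z ** 0) $ i $ j) (at z)"
        by (rule matrix_mult_has_field_derivative[OF dM]) simp
      from DERIV_diff[OF dN this] 
      show "((\<lambda>w. (N w - M w ** C) $ i $ j) has_field_derivative
          (tac_U \<nu> q s \<tau> z ** (N z - M z ** C)) $ i $ j) (at z)"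
        by (simp add: matrix_mul_assoc matrix_mult_diff_ldistrib)
    next
      show "N (of_real x) - M (of_real x) ** C = 0"
        by (simp add: C_def matrix_mul_assoc M')
    qed
    then show ?thesis by simp
  qed

  \<comment> \<open>Cancelling \<open>W\<close> and the exponentials in \<open>N = M ** C\<close>
    gives \<open>mat 1 + B z = (mat 1 + A z) ** X z\<close>.\<close>
  define X where "X z = \<Lambda> z ** C ** \<Lambda>' z" for z
  have not_neg: "\<forall>\<^sub>F z in sector_at_infinity. z \<notin> \<real>\<^sub>\<le>\<^sub>0"
  proof -
    have "\<forall>\<^sub>F z in sector_at_infinity. z \<in> tac_sector"
      by (simp add: eventually_inf_principal)
    with ge1 show ?thesis
    proof eventually_elim
      case (elim z)
      show ?case
      proof
        assume "z \<in> \<real>\<^sub>\<le>\<^sub>0"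
        then have "Re z \<le> 0" "Im z = 0"
          by (auto simp: complex_nonpos_Reals_iff)
        moreover from this have "Re z \<noteq> 0"
          using elim(1) by (auto simp: cmod_def)
        ultimately have "Arg z = pi"
          by (simp add: Arg_eq_pi)
        with elim(2) show False
          using pi_gt_zero by (simp add: tac_sector_def)
      qed
    qed
  qed
  have X: "\<forall>\<^sub>F z in sector_at_infinity. mat 1 + B z = (mat 1 + A z) ** X z"
    using MA NB ge1 not_neg
  proof eventually_elim
    case (elim z)
    then have "z \<noteq> 0" by auto
    have "W' z ** (N z ** \<Lambda>' z) = W' z ** (M z ** C ** \<Lambda>' z)"
      by (simp add: NMC[OF elim(4)])
    also have "W' z ** (N z ** \<Lambda>' z) = (W' z ** W z) ** (mat 1 + B z) ** (\<Lambda> z ** \<Lambda>' z)"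
      unfolding elim(2) by (simp only: matrix_mul_assoc)
    also have "W' z ** (M z ** C ** \<Lambda>' z) = (W' z ** W z) ** (mat 1 + A z) ** X z"
      unfolding elim(1) X_def by (simp only: matrix_mul_assoc)
    finally show ?case
      by (simp add: W[OF \<open>z \<noteq> 0\<close>] \<Lambda>)
  qed
  have "\<exists>K>0. \<forall>(X :: complex ^ 4 ^ 4) (Y :: complex ^ 4 ^ 4). norm (X ** Y) \<le> K * norm X * norm Y"
    by (rule bilinear_bounded_pos[OF bilinear_matrix_mult])
  then obtain K where K: "K > 0" "\<And>(X :: complex ^ 4 ^ 4) (Y :: complex ^ 4 ^ 4). norm (X ** Y) \<le> K * norm X * norm Y"
    by blast
  \<comment> \<open>From \<open>X - mat 1 = B - A ** (X - mat 1) - A\<close>, the middle term is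
    absorbed into the left side once \<open>K * norm (A z) < 1 / 2\<close>. No prior bound on
    \<open>X\<close> is assumed.\<close>
  have lim: "((\<lambda>z. X z - mat 1) \<longlongrightarrow> 0) sector_at_infinity"
  proof (rule Lim_null_comparison)
    have "((\<lambda>z. K * norm (A z)) \<longlongrightarrow> K * norm (0 :: complex ^ 4 ^ 4)) sector_at_infinity"
      by (intro tendsto_intros A)
    then have "\<forall>\<^sub>F z in sector_at_infinity. K * norm (A z) < 1 / 2"
      by (rule order_tendstoD(2)) simp
    then show "\<forall>\<^sub>F z in sector_at_infinity. norm (X z - mat 1) \<le>
        2 * norm (B z) + 2 * (K * norm (A z) * norm (mat 1 :: complex ^ 4 ^ 4))"
      using X
    proof eventually_elim
      case (elim z)
      have "X z - mat 1 = B z - A z ** (X z - mat 1) - A z ** mat 1"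
        using elim(2) by (simp add: matrix_mult_diff_ldistrib) (simp add: matrix_mult_add_rdistrib algebra_simps)
      then have "norm (X z - mat 1) = norm (B z - A z ** (X z - mat 1) - A z ** mat 1)"
        by (rule arg_cong)
      also have "\<dots> \<le> norm (B z) + norm (A z ** (X z - mat 1)) + norm (A z ** mat 1)"
        by (rule order_trans[OF norm_triangle_ineq4 add_right_mono[OF norm_triangle_ineq4]])
      also have "norm (A z ** (X z - mat 1)) \<le> K * norm (A z) * norm (X z - mat 1)"
        by (rule K(2))
      also have "\<dots> \<le> 1 / 2 * norm (X z - mat 1)"
        using elim(1) by (intro mult_right_mono) auto
      also have "norm (A z ** mat 1) \<le> K * norm (A z) * norm (mat 1 :: complex ^ 4 ^ 4)"
        by (rule K(2))
      finally show ?case by simp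
    qed
    have "((\<lambda>z. 2 * norm (B z) + 2 * (K * norm (A z) * norm (mat 1 :: complex ^ 4 ^ 4)))
        \<longlongrightarrow> 2 * norm (0 :: complex ^ 4 ^ 4) + 2 * (K * norm (0 :: complex ^ 4 ^ 4) * norm (mat 1 :: complex ^ 4 ^ 4)))
        sector_at_infinity"
      by (intro tendsto_intros A B)
    then show "((\<lambda>z. 2 * norm (B z) + 2 * (K * norm (A z) * norm (mat 1 :: complex ^ 4 ^ 4))) \<longlongrightarrow> 0) sector_at_infinity"
      by simp
  qed
  have X_nth: "X z $ i $ j = exp (tac_exponent s \<tau> z $ i - tac_exponent s \<tau> z $ j) * C $ i $ j" for z i j
    by (simp add: X_def \<Lambda>_def \<Lambda>'_def diag_mat_mult_nth mult_diag_mat_nth exp_diff exp_minus divide_inverse)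
  \<comment> \<open>Diagonal entries of \<open>X\<close> and \<open>C\<close> coincide. Off the
    diagonal, a ray on which exponent \<open>i\<close> has the larger real part gives
    \<open>norm (C $ i $ j) \<le> norm (X z $ i $ j)\<close>, and the right side tends to 0.\<close>
  have "C $ i $ j = (mat 1 :: complex ^ 4 ^ 4) $ i $ j" for i j
  proof (cases "i = j")
    case True
    have "((\<lambda>z. (X z - mat 1) $ i $ i) \<longlongrightarrow> 0 $ i $ i) sector_at_infinity"
      by (intro tendsto_vec_nth lim)
    moreover have "sector_at_infinity \<noteq> bot"
    proof
      assume "sector_at_infinity = bot"
      then have "filterlim (\<lambda>r. of_real r * cis 0) (bot :: complex filter) at_top"
        using filterlim_ray_sector[of 0] by simp
      then show False
        by (simp add: filterlim_def bot_unique filtermap_bot_iff)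
    qed
    ultimately have "C $ i $ i - 1 = 0"
      by (simp add: X_nth mat_def tendsto_const_iff)
    with True show ?thesis by (simp add: mat_def)
  next
    case False
    obtain \<phi> where \<phi>: "- pi / 12 < \<phi>" "\<phi> < 7 * pi / 12"
      and le: "\<forall>\<^sub>F r in at_top. Re (tac_exponent s \<tau> (of_real r * cis \<phi>) $ j)
          \<le> Re (tac_exponent s \<tau> (of_real r * cis \<phi>) $ i)"
      using dominating_ray[OF False] by blast
    have "((\<lambda>z. norm ((X z - mat 1) $ i $ j)) \<longlongrightarrow> norm ((0 :: complex ^ 4 ^ 4) $ i $ j)) sector_at_infinity"
      by (intro tendsto_norm tendsto_vec_nth lim)
    from filterlim_compose[OF this filterlim_ray_sector[OF \<phi>]]
    have "((\<lambda>r. norm (X (of_real r * cis \<phi>) $ i $ j)) \<longlongrightarrow> 0) at_top"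
      using False by (simp add: mat_def)
    moreover have "\<forall>\<^sub>F r in at_top. norm (C $ i $ j) \<le> norm (X (of_real r * cis \<phi>) $ i $ j)"
      using le
    proof eventually_elim
      case (elim r)
      then have "1 * norm (C $ i $ j) \<le> norm (X (of_real r * cis \<phi>) $ i $ j)"
        unfolding X_nth norm_mult norm_exp_eq_Re by (intro mult_right_mono) auto
      then show ?case by simp
    qed
    ultimately have "norm (C $ i $ j) \<le> 0"
      by (rule tendsto_lowerbound) simp
    with False show ?thesis by (simp add: mat_def)
  qed
  then have "C = mat 1"
    by (simp add: vec_eq_iff)
  with NMC[OF z] show ?thesis by simp
qed

section \<open>The gauge transformation\<close>

lemma mat_commute: "A ** mat c = mat c ** A" for A :: "'a::comm_semiring_1 ^ 'n ^ 'n"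
  by (simp add: vec_eq_iff mat_mult_nth)
     (simp add: matrix_matrix_mult_def mat_def if_distrib[of "\<lambda>x. _ * x"] mult.commute cong: if_cong)

text \<open>Powers of \<open>z\<close> are compared. The order \<open>z\<close> terms agree; order 0
  is hypothesis \<open>V\<close>; order \<open>1 / z\<close> is \<open>RV\<close> multiplied by
  \<open>\<alpha>\<close>, with \<open>\<alpha> * x = n + (n + 1)\<close>; order
  \<open>1 / z^2\<close> reads \<open>- 1 - n = - (n + 1)\<close> times \<open>\<alpha>\<close> and
  \<open>R\<close>, by \<open>RJ\<close> and \<open>JR\<close>.\<close>

lemma gauge_identity_of_coefficients:
  fixes R V U Z J :: "complex ^ 'n ^ 'n"
  assumes RJ: "R ** J = R" and JR: "J ** R = - R"
    and RV: "R ** V = U ** R + mat x ** J"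
    and V: "V + mat \<alpha> ** (R ** Z) = U + mat \<alpha> ** (Z ** R)"
    and n: "\<alpha> * x = 2 * n + 1" and z: "z \<noteq> 0"
  shows "mat (- \<alpha> / z^2) ** R + (mat 1 + mat (\<alpha> / z) ** R) ** (V + mat z ** Z + mat (- n / z) ** J) =
    (U + mat z ** Z + mat ((n + 1) / z) ** J) ** (mat 1 + mat (\<alpha> / z) ** R)"
proof -
  have left: "(mat c ** A) ** B = mat c ** (A ** B)"
    and right: "A ** (mat c ** B) = mat c ** (A ** B)" for c and A B :: "complex ^ 'n ^ 'n"
    by (simp_all only: matrix_mul_assoc mat_commute[of A])
  define w where "w = inverse z"
  have w: "w * z = 1" "z * w = 1" "w * (z * y) = y" "z * (w * y) = y" for y
    using z by (simp_all add: w_def)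
  have div: "y / z = y * w" "y / z^2 = y * w * w" for y
    by (simp_all add: w_def divide_inverse power2_eq_square)
  have n': "n = \<alpha> * x * (1 / 2) - 1 / 2"
    using n by (simp add: field_simps)
  show ?thesis
    unfolding vec_eq_iff
  proof (intro allI)
    fix i j
    have V': "V $ i $ j = U $ i $ j + \<alpha> * (Z ** R) $ i $ j - \<alpha> * (R ** Z) $ i $ j"
      using arg_cong[OF V, of "\<lambda>A. A $ i $ j"]
      by (simp only: vector_add_component mat_mult_nth) (simp add: algebra_simps)
    have RV': "(R ** V) $ i $ j = (U ** R) $ i $ j + x * J $ i $ j"
      using RV by (simp only: vector_add_component mat_mult_nth)
    show "(mat (- \<alpha> / z^2) ** R + (mat 1 + mat (\<alpha> / z) ** R)
          ** (V + mat z ** Z + mat (- n / z) ** J)) $ i $ j =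
      ((U + mat z ** Z + mat ((n + 1) / z) ** J) ** (mat 1 + mat (\<alpha> / z) ** R)) $ i $ j"
      unfolding matrix_add_ldistrib matrix_mult_add_rdistrib left right[of R] right[of U] right[of Z] right[of J] matrix_mul_lid matrix_mul_rid
        vector_add_component vector_uminus_component mat_mult_nth RJ JR RV' V' div n'
      by (simp add: algebra_simps w)
  qed
qed

text \<open>The condition on the gauge factor as an identity in free complex parameters. Names with
  suffix 1 are the coefficients of the system for \<open>n + 1\<close>, and the last hypothesis is
  the compatibility of the \<open>1 / z\<close> terms.\<close>

lemma lax_gauge_identity:
  fixes c d G H s t n \<alpha> z :: complex
  defines "c1 \<equiv> c - \<alpha>" and "d1 \<equiv> \<alpha> - d"
    and "G1 \<equiv> G + 2 * \<alpha> * (c - d)" and "H1 \<equiv> 2 * \<alpha> * (c - d) - H"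
  defines "\<beta> \<equiv> c + t - d" and "\<delta> \<equiv> c - t - d" and "\<gamma> \<equiv> G + H + s"
  defines "R \<equiv> mat4 [[\<beta>, \<beta>, - \<i>, \<i>], [- \<beta>, - \<beta>, \<i>, - \<i>],
      [\<i> * \<gamma>, \<i> * \<gamma>, - \<delta>, \<delta>], [\<i> * \<gamma>, \<i> * \<gamma>, - \<delta>, \<delta>]]"
  assumes z: "z \<noteq> 0" and G: "G = - (c^2) + d^2 + s"
    and n: "2 * \<alpha> * (\<gamma> + \<beta> * \<delta>) = 2 * n + 1"
  shows "mat (- \<alpha> / z^2) ** R + (mat 1 + mat (\<alpha> / z) ** R) **
      (tac_Sigma ** mat4
        [[- c + t, d + n / z, \<i>, 0], [- d + n / z, c - t, 0, \<i>],
         [- \<i> * (- z + G + s), - \<i> * H, c + t, d - n / z],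
         [- \<i> * H, - \<i> * (z + G + s), - d - n / z, - c - t]] ** tac_Sigma) =
      mat4
        [[- c1 + t, d1 + (n + 1) / z, \<i>, 0], [- d1 + (n + 1) / z, c1 - t, 0, \<i>],
         [- \<i> * (- z + G1 + s), - \<i> * H1, c1 + t, d1 - (n + 1) / z],
         [- \<i> * H1, - \<i> * (z + G1 + s), - d1 - (n + 1) / z, - c1 - t]] **
      (mat 1 + mat (\<alpha> / z) ** R)"
proof -
  \<comment> \<open>In terms of \<open>e = c - d\<close> the quantity \<open>G\<close> becomes a
    polynomial without \<open>c\<close>, so that \<open>c\<close> and \<open>G\<close> can be
    eliminated together.\<close>
  define e where "e = c - d"
  have c: "c = d + e"
    by (simp add: e_def)
  have G': "G = s - e * e - 2 * d * e"
    unfolding G c by (simp add: power2_eq_square algebra_simps)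
  \<comment> \<open>\<open>Z\<close> and \<open>J\<close> carry the terms in \<open>z\<close> and
    \<open>1 / z\<close>; \<open>V\<close> and \<open>U\<close> are the constant terms before and
    after the transformation. Conjugation by \<open>tac_Sigma\<close> fixes \<open>Z\<close> and
    negates \<open>J\<close>, which turns \<open>n\<close> into \<open>- n\<close>.\<close>
  define Z where "Z = mat4 [[0, 0, 0, 0], [0, 0, 0, 0], [\<i>, 0, 0, 0], [0, - \<i>, 0, 0]]"
  define J where "J = mat4 [[0, 1, 0, 0], [1, 0, 0, 0], [0, 0, 0, - 1], [0, 0, - 1, 0]]"
  define V where "V = mat4 [[- c + t, - d, \<i>, 0], [d, c - t, 0, \<i>],
    [- \<i> * (G + s), \<i> * H, c + t, - d], [\<i> * H, - \<i> * (G + s), d, - c - t]]"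
  define U where "U = mat4 [[- c1 + t, d1, \<i>, 0], [- d1, c1 - t, 0, \<i>],
    [- \<i> * (G1 + s), - \<i> * H1, c1 + t, d1], [- \<i> * H1, - \<i> * (G1 + s), - d1, - c1 - t]]"
  have "R ** J = R" "J ** R = - R"
    by (simp_all add: R_def J_def mat4_mult vec_eq_iff forall_4) (simp_all add: mat4_def)
  moreover have "R ** V = U ** R + mat (2 * (\<gamma> + \<beta> * \<delta>)) ** J"
    unfolding R_def V_def U_def J_def mat4_mult mat4_cmult mat4_add
      \<beta>_def \<gamma>_def \<delta>_def G1_def H1_def c1_def d1_def G' c
    by (simp add: algebra_simps)
  moreover have "V + mat \<alpha> ** (R ** Z) = U + mat \<alpha> ** (Z ** R)"
    unfolding R_def V_def U_def Z_def mat4_mult mat4_cmult mat4_add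
      \<beta>_def \<gamma>_def \<delta>_def G1_def H1_def c1_def d1_def
    by (simp add: algebra_simps)
  moreover have "\<alpha> * (2 * (\<gamma> + \<beta> * \<delta>)) = 2 * n + 1"
    unfolding n[symmetric] by simp
  ultimately have "mat (- \<alpha> / z^2) ** R
      + (mat 1 + mat (\<alpha> / z) ** R) ** (V + mat z ** Z + mat (- n / z) ** J) =
    (U + mat z ** Z + mat ((n + 1) / z) ** J) ** (mat 1 + mat (\<alpha> / z) ** R)"
    using z by (rule gauge_identity_of_coefficients)
  moreover have "tac_Sigma ** mat4
        [[- c + t, d + n / z, \<i>, 0], [- d + n / z, c - t, 0, \<i>],
         [- \<i> * (- z + G + s), - \<i> * H, c + t, d - n / z],
         [- \<i> * H, - \<i> * (z + G + s), - d - n / z, - c - t]] ** tac_Sigma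
      = V + mat z ** Z + mat (- n / z) ** J"
    unfolding V_def Z_def J_def tac_Sigma_def diag4_def mat4_mult mat4_cmult mat4_add
    by (simp add: algebra_simps)
  moreover have "mat4
        [[- c1 + t, d1 + (n + 1) / z, \<i>, 0], [- d1 + (n + 1) / z, c1 - t, 0, \<i>],
         [- \<i> * (- z + G1 + s), - \<i> * H1, c1 + t, d1 - (n + 1) / z],
         [- \<i> * H1, - \<i> * (z + G1 + s), - d1 - (n + 1) / z, - c1 - t]]
      = U + mat z ** Z + mat ((n + 1) / z) ** J"
    unfolding U_def Z_def J_def mat4_cmult mat4_add
    by (simp add: algebra_simps add_divide_distrib diff_divide_distrib)
  ultimately show ?thesis
    by (simp only:)
qed

section \<open>The gauge factor and the expansion at infinity\<close>

lemma mat_mult_mat: "mat c ** mat d = mat (c * d)" for c d :: "'a::semiring_1"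
  by (simp add: vec_eq_iff mat_mult_nth) (simp add: mat_def)

lemma tac_Sigma_mult_self: "tac_Sigma ** tac_Sigma = mat 1"
  by (simp add: tac_Sigma_def diag4_def mat4_mult mat_eq_mat4[of 1])

text \<open>\<open>tac_A\<close> couples only indices 1 with 3 and 2 with 4, where
  \<open>tac_Sigma\<close> has equal signs, and the other factors are diagonal.\<close>

lemma tac_Sigma_model: "tac_Sigma ** tac_model s \<tau> z ** tac_Sigma = tac_model s \<tau> z"
  by (simp add: tac_Sigma_def tac_model_def diag4_def tac_A_def mat4_cmult mat4_mult)

text \<open>Inserting \<open>Sg ** Sg = mat 1\<close> moves the conjugation onto the expansion.
  Multiplying out then isolates the new \<open>1 / z\<close> coefficient; everything in the last
  bracket is of second order.\<close>

lemma tac_gauge_algebra: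
  fixes Sg R M1 E T :: "complex ^ 4 ^ 4"
  assumes "Sg ** T ** Sg = T" "Sg ** Sg = mat 1"
  shows "(mat 1 + mat (\<alpha> / z) ** R) ** Sg ** ((mat 1 + mat (1 / z) ** M1 + E) ** T) ** Sg =
    (mat 1 + mat (1 / z) ** (mat \<alpha> ** R + Sg ** M1 ** Sg)
      + (Sg ** E ** Sg + mat (\<alpha> / z) ** (R ** (mat (1 / z) ** (Sg ** M1 ** Sg) + Sg ** E ** Sg)))) ** T"
proof -
  have "Sg ** ((mat 1 + mat (1 / z) ** M1 + E) ** T) ** Sg
      = Sg ** (mat 1 + mat (1 / z) ** M1 + E) ** (Sg ** Sg) ** T ** Sg"
    by (simp add: assms(2) matrix_mul_assoc)
  also have "\<dots> = (Sg ** (mat 1 + mat (1 / z) ** M1 + E) ** Sg) ** (Sg ** T ** Sg)"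
    by (simp only: matrix_mul_assoc)
  also have "Sg ** (mat 1 + mat (1 / z) ** M1 + E) ** Sg
      = mat 1 + mat (1 / z) ** (Sg ** M1 ** Sg) + Sg ** E ** Sg"
  proof -
    have "Sg ** (mat (1 / z) ** M1) ** Sg = mat (1 / z) ** (Sg ** M1 ** Sg)"
      by (simp only: matrix_mul_assoc mat_commute[of Sg])
    then show ?thesis
      by (simp add: matrix_add_ldistrib matrix_mult_add_rdistrib assms(2))
  qed
  finally have inner: "Sg ** ((mat 1 + mat (1 / z) ** M1 + E) ** T) ** Sg
      = (mat 1 + mat (1 / z) ** (Sg ** M1 ** Sg) + Sg ** E ** Sg) ** T"
    unfolding assms(1) .
  have "(mat 1 + mat (\<alpha> / z) ** R) ** Sg ** ((mat 1 + mat (1 / z) ** M1 + E) ** T) ** Sg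
      = (mat 1 + mat (\<alpha> / z) ** R) ** (Sg ** ((mat 1 + mat (1 / z) ** M1 + E) ** T) ** Sg)"
    by (simp only: matrix_mul_assoc)
  also note inner
  finally have "(mat 1 + mat (\<alpha> / z) ** R) ** Sg ** ((mat 1 + mat (1 / z) ** M1 + E) ** T) ** Sg
      = (mat 1 + mat (\<alpha> / z) ** R) ** ((mat 1 + mat (1 / z) ** (Sg ** M1 ** Sg) + Sg ** E ** Sg) ** T)" .
  moreover have "mat (\<alpha> / z) = mat (1 / z) ** (mat \<alpha> :: complex ^ 4 ^ 4)"
    by (simp add: mat_mult_mat)
  ultimately show ?thesis
    by (simp add: matrix_add_ldistrib matrix_mult_add_rdistrib add_ac flip: matrix_mul_assoc)
qed

text \<open>All fractional powers of 2 are expressed through one \<open>k\<close> with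
  \<open>2 * k ^ 3 = 1\<close>, so the coefficient identities become polynomial.\<close>

lemma two_powr_thirds:
  obtains k :: real where "k > 0" "2 * k ^ 3 = 1" "2 powr (-1/3) = k" "2 powr (-2/3) = k^2"
    "2 powr (1/3) = 2 * k^2" "2 powr (2/3) = 2 * k" "2 powr (5/3) = 4 * k"
proof
  let ?k = "2 powr (-1/3) :: real"
  show "?k > 0" "2 powr (-1/3) = ?k" by simp_all
  have "?k ^ 3 = 2 powr - 1"
    by (simp add: powr_power)
  then show "2 * ?k ^ 3 = 1"
    by simp
  show two: "2 powr (-2/3) = ?k^2"
    by (simp add: powr_power)
  show "2 powr (1/3) = 2 * ?k^2"
    using powr_add[of "2 :: real" 1 "-2/3"] unfolding two by simp
  show "2 powr (2/3) = 2 * ?k"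
    using powr_add[of "2 :: real" 1 "-1/3"] by simp
  show "2 powr (5/3) = 4 * ?k"
    using powr_add[of "2 :: real" 2 "-1/3"] by simp
qed

section \<open>The step from \<open>\<nu>\<close> to \<open>\<nu> + 1\<close> for the coefficients
  and for \<open>M\<close>\<close>

context painleve_pair
begin

context
  fixes s \<tau> :: real
begin

definition \<alpha> :: real where "\<alpha> = 2 powr (-1/3) * (q1 (pII_sigma s \<tau>) + q (pII_sigma s \<tau>))"

lemma tac_c_step: "tac_c (\<nu> + 1) q1 s \<tau> = tac_c \<nu> q s \<tau> - \<alpha>"
proof -
  have "pII_u (\<nu> + 1) q1 (pII_sigma s \<tau>) = pII_u \<nu> q (pII_sigma s \<tau>) + (q1 (pII_sigma s \<tau>) + q (pII_sigma s \<tau>))"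
    using pII_u_diff[of "pII_sigma s \<tau>"] by simp
  then show ?thesis
    by (simp add: tac_c_def \<alpha>_def algebra_simps)
qed

lemma tac_d_step: "tac_d q1 s \<tau> = \<alpha> - tac_d q s \<tau>"
  by (simp add: tac_d_def \<alpha>_def algebra_simps)

text \<open>This and the next two identities express the entries of \<open>tac_R\<close> through the
  coefficients of the system, the form used in \<open>lax_gauge_identity\<close>.\<close>

lemma tac_beta_eq: "tac_beta \<nu> q s \<tau> = tac_c \<nu> q s \<tau> + \<tau> - tac_d q s \<tau>"
  by (simp add: tac_beta_def tac_c_def tac_d_def algebra_simps)

lemma tac_delta_eq: "tac_delta \<nu> q s \<tau> = tac_c \<nu> q s \<tau> - \<tau> - tac_d q s \<tau>"
  by (simp add: tac_delta_def tac_c_def tac_d_def algebra_simps)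

lemma tac_gamma_eq: "tac_gamma \<nu> q s \<tau> = tac_G \<nu> q s \<tau> + tac_H \<nu> q s \<tau> + s"
proof -
  obtain k :: real where k: "k > 0" "2 * k ^ 3 = 1" "2 powr (-1/3) = k" "2 powr (-2/3) = k^2"
    "2 powr (1/3) = 2 * k^2" "2 powr (2/3) = 2 * k" "2 powr (5/3) = 4 * k"
    by (rule two_powr_thirds)
  show ?thesis
    unfolding tac_gamma_def tac_G_def tac_H_def tac_c_def tac_d_def Let_def k
    by (simp add: algebra_simps power2_eq_square power4_eq_xxxx)
qed

lemma tac_G_step: "tac_G (\<nu> + 1) q1 s \<tau> = tac_G \<nu> q s \<tau> + 2 * \<alpha> * (tac_c \<nu> q s \<tau> - tac_d q s \<tau>)"
  unfolding tac_G_def tac_c_step tac_d_step by (simp add: power2_eq_square algebra_simps)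

text \<open>By \<open>deriv_q1_eq\<close> and \<open>pII_u_diff\<close>, the sum of
  \<open>q' + q * u\<close> for both parameters equals \<open>(q + q1) * (q + u)\<close>, so the two
  values of \<open>tac_H\<close> add up to a multiple of \<open>\<alpha>\<close>.\<close>

lemma tac_H_step: "tac_H (\<nu> + 1) q1 s \<tau> = 2 * \<alpha> * (tac_c \<nu> q s \<tau> - tac_d q s \<tau>) - tac_H \<nu> q s \<tau>"
proof -
  obtain k :: real where k: "k > 0" "2 * k ^ 3 = 1" "2 powr (-1/3) = k" "2 powr (-2/3) = k^2"
    "2 powr (1/3) = 2 * k^2" "2 powr (2/3) = 2 * k" "2 powr (5/3) = 4 * k"
    by (rule two_powr_thirds)
  have u1: "pII_u (\<nu> + 1) q1 (pII_sigma s \<tau>)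
      = pII_u \<nu> q (pII_sigma s \<tau>) + (q1 (pII_sigma s \<tau>) + q (pII_sigma s \<tau>))"
    using pII_u_diff[of "pII_sigma s \<tau>"] by simp
  show ?thesis
    unfolding tac_H_def tac_c_def tac_d_def \<alpha>_def k u1 deriv_q1_eq
    by (simp add: algebra_simps power2_eq_square)
qed

lemma F_pII_sigma:
  "F (pII_sigma s \<tau>) = 2 * (q (pII_sigma s \<tau>))^2 - 2 * deriv q (pII_sigma s \<tau>)
     + 2 powr (5/3) * s - 2 powr (2/3) * \<tau>^2"
proof -
  have "(2 :: real) powr (5/3) = 2 * 2 powr (2/3)"
    using powr_add[of "2 :: real" 1 "2/3"] by simp
  then show ?thesis
    by (simp add: F_def pII_sigma_def algebra_simps)
qed

text \<open>The bracket equals \<open>k^2 * F\<close>, whereas \<open>\<alpha> = k * a / F\<close>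
  by the Baecklund transformation; the product is \<open>2 * k ^ 3 * a = a\<close>.\<close>

lemma alpha_relation:
  "2 * \<alpha> * (tac_gamma \<nu> q s \<tau> + tac_beta \<nu> q s \<tau> * tac_delta \<nu> q s \<tau>) = 2 * \<nu> + 1"
proof -
  obtain k :: real where k: "k > 0" "2 * k ^ 3 = 1" "2 powr (-1/3) = k" "2 powr (-2/3) = k^2"
    "2 powr (1/3) = 2 * k^2" "2 powr (2/3) = 2 * k" "2 powr (5/3) = 4 * k"
    by (rule two_powr_thirds)
  let ?\<sigma> = "pII_sigma s \<tau>"
  have "tac_gamma \<nu> q s \<tau> + tac_beta \<nu> q s \<tau> * tac_delta \<nu> q s \<tau>
      = 2 * (tac_d q s \<tau>)^2 - 2 * tac_c \<nu> q s \<tau> * tac_d q s \<tau> + tac_H \<nu> q s \<tau> + 2 * s - \<tau>^2"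
    unfolding tac_gamma_eq tac_beta_eq tac_delta_eq tac_G_def
    by (simp add: power2_eq_square algebra_simps)
  also have "\<dots> = 2 * k^2 * (q ?\<sigma>)^2 - 2 * k^2 * deriv q ?\<sigma> + 2 * s - \<tau>^2"
    unfolding tac_H_def tac_c_def tac_d_def k by (simp add: power2_eq_square algebra_simps)
  \<comment> \<open>The factor \<open>2 * k ^ 3 = 1\<close> is inserted because
    \<open>2 * k * (2 * s - \<tau>^2)\<close> is the argument
    \<open>pII_sigma s \<tau>\<close>.\<close>
  also have "\<dots> = 2 * k^2 * (q ?\<sigma>)^2 - 2 * k^2 * deriv q ?\<sigma> + (2 * k ^ 3) * (2 * s - \<tau>^2)"
    unfolding k(2) by simp
  also have "\<dots> = k^2 * F ?\<sigma>"
    unfolding F_pII_sigma k(6,7) by (simp add: power2_eq_square power3_eq_cube algebra_simps)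
  finally have "2 * \<alpha> * (tac_gamma \<nu> q s \<tau> + tac_beta \<nu> q s \<tau> * tac_delta \<nu> q s \<tau>)
      = 2 * (k * (a / F ?\<sigma>)) * (k^2 * F ?\<sigma>)"
    unfolding \<alpha>_def k q_plus_q1 by simp
  also have "\<dots> = (2 * k ^ 3) * a"
    using F_pos[of ?\<sigma>] by (simp add: power2_eq_square power3_eq_cube)
  finally show ?thesis
    unfolding k(2) by (simp add: a_def)
qed

lemma tac_U_gauge:
  assumes "z \<noteq> 0"
  shows "mat (- of_real \<alpha> / z^2) ** tac_R \<nu> q s \<tau>
      + (mat 1 + mat (of_real \<alpha> / z) ** tac_R \<nu> q s \<tau>) ** (tac_Sigma ** tac_U \<nu> q s \<tau> z ** tac_Sigma)
    = tac_U (\<nu> + 1) q1 s \<tau> z ** (mat 1 + mat (of_real \<alpha> / z) ** tac_R \<nu> q s \<tau>)"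
proof -
  have "complex_of_real (tac_G \<nu> q s \<tau>) = - (of_real (tac_c \<nu> q s \<tau>)^2) + of_real (tac_d q s \<tau>)^2 + of_real s"
    by (simp add: tac_G_def)
  moreover have "complex_of_real (2 * \<alpha> * (tac_gamma \<nu> q s \<tau> + tac_beta \<nu> q s \<tau> * tac_delta \<nu> q s \<tau>))
      = of_real (2 * \<nu> + 1)"
    unfolding alpha_relation ..
  then have "2 * complex_of_real \<alpha> *
      ((of_real (tac_G \<nu> q s \<tau>) + of_real (tac_H \<nu> q s \<tau>) + of_real s)
        + (of_real (tac_c \<nu> q s \<tau>) + of_real \<tau> - of_real (tac_d q s \<tau>))
          * (of_real (tac_c \<nu> q s \<tau>) - of_real \<tau> - of_real (tac_d q s \<tau>)))
      = 2 * of_real \<nu> + 1"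
    by (simp add: tac_gamma_eq tac_beta_eq tac_delta_eq)
  ultimately show ?thesis
    using lax_gauge_identity[OF assms, of "of_real (tac_G \<nu> q s \<tau>)" "of_real (tac_c \<nu> q s \<tau>)"
        "of_real (tac_d q s \<tau>)" "of_real s" "of_real \<alpha>" "of_real (tac_H \<nu> q s \<tau>)" "of_real \<tau>" "of_real \<nu>"]
    unfolding tac_R_def tac_U_def tac_beta_eq tac_delta_eq tac_gamma_eq
      tac_c_step tac_d_step tac_G_step tac_H_step Let_def
    by simp
qed

text \<open>\<open>tac_U_gauge\<close> turns the product rule into the system for
  \<open>\<nu> + 1\<close>, and \<open>tac_gauge_algebra\<close> supplies the expansion with the
  same model.\<close>

lemma is_tac_M_gauge:
  assumes "is_tac_M \<nu> q s \<tau> M"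
  shows "is_tac_M (\<nu> + 1) q1 s \<tau>
    (\<lambda>z. (mat 1 + mat (of_real \<alpha> / z) ** tac_R \<nu> q s \<tau>) ** tac_Sigma ** M z ** tac_Sigma)"
proof -
  define R where "R = tac_R \<nu> q s \<tau>"
  define L where "L z = mat 1 + mat (of_real \<alpha> / z) ** R" for z
  have deriv: "((\<lambda>w. (L w ** tac_Sigma ** M w ** tac_Sigma) $ i $ j) has_field_derivative
      (tac_U (\<nu> + 1) q1 s \<tau> z ** (L z ** tac_Sigma ** M z ** tac_Sigma)) $ i $ j) (at z)"
    if z: "z \<notin> \<real>\<^sub>\<le>\<^sub>0" for z i j
  proof -
    have "z \<noteq> 0" using z by auto
    have dM: "((\<lambda>w. M w $ i $ j) has_field_derivative (tac_U \<nu> q s \<tau> z ** M z) $ i $ j) (at z)" for i j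
      using assms z unfolding is_tac_M_def by blast
    have dL: "((\<lambda>w. L w $ i $ j) has_field_derivative (mat (- of_real \<alpha> / z^2) ** R) $ i $ j) (at z)" for i j
      unfolding L_def vector_add_component mat_mult_nth using \<open>z \<noteq> 0\<close>
      by (auto intro!: derivative_eq_intros simp: power2_eq_square)
    have dS: "((\<lambda>w. tac_Sigma $ i $ j) has_field_derivative (0 :: complex ^ 4 ^ 4) $ i $ j) (at z)" for i j
      by simp
    have "((\<lambda>w. (L w ** tac_Sigma ** M w ** tac_Sigma) $ i $ j) has_field_derivative
        ((((mat (- of_real \<alpha> / z^2) ** R) ** tac_Sigma + L z ** 0) ** M z
          + (L z ** tac_Sigma) ** (tac_U \<nu> q s \<tau> z ** M z)) ** tac_Sigma
          + (L z ** tac_Sigma ** M z) ** 0) $ i $ j) (at z)"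
      by (intro matrix_mult_has_field_derivative dM dL dS)
    moreover have "(((mat (- of_real \<alpha> / z^2) ** R) ** tac_Sigma + L z ** 0) ** M z
          + (L z ** tac_Sigma) ** (tac_U \<nu> q s \<tau> z ** M z)) ** tac_Sigma
          + (L z ** tac_Sigma ** M z) ** 0
        = tac_U (\<nu> + 1) q1 s \<tau> z ** (L z ** tac_Sigma ** M z ** tac_Sigma)"
    proof -
      have zero: "X ** 0 = 0" for X :: "complex ^ 4 ^ 4"
        by (simp add: vec_eq_iff matrix_matrix_mult_def)
      \<comment> \<open>\<open>tac_Sigma ** tac_Sigma = mat 1\<close> is inserted to form the
        conjugate of \<open>tac_U\<close> that occurs in \<open>tac_U_gauge\<close>.\<close>
      have "(L z ** tac_Sigma) ** (tac_U \<nu> q s \<tau> z ** M z)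
          = L z ** tac_Sigma ** tac_U \<nu> q s \<tau> z ** (tac_Sigma ** tac_Sigma) ** M z"
        by (simp add: tac_Sigma_mult_self matrix_mul_assoc)
      then have "(L z ** tac_Sigma) ** (tac_U \<nu> q s \<tau> z ** M z)
          = (L z ** (tac_Sigma ** tac_U \<nu> q s \<tau> z ** tac_Sigma)) ** tac_Sigma ** M z"
        by (simp only: matrix_mul_assoc)
      then have "(((mat (- of_real \<alpha> / z^2) ** R) ** tac_Sigma + L z ** 0) ** M z
          + (L z ** tac_Sigma) ** (tac_U \<nu> q s \<tau> z ** M z)) ** tac_Sigma
          + (L z ** tac_Sigma ** M z) ** 0
        = (mat (- of_real \<alpha> / z^2) ** R + L z ** (tac_Sigma ** tac_U \<nu> q s \<tau> z ** tac_Sigma))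
            ** tac_Sigma ** M z ** tac_Sigma"
        by (simp add: zero matrix_mult_add_rdistrib)
      also have "mat (- of_real \<alpha> / z^2) ** R + L z ** (tac_Sigma ** tac_U \<nu> q s \<tau> z ** tac_Sigma)
          = tac_U (\<nu> + 1) q1 s \<tau> z ** L z"
        unfolding L_def R_def by (rule tac_U_gauge[OF \<open>z \<noteq> 0\<close>])
      finally show ?thesis
        by (simp only: matrix_mul_assoc)
    qed
    ultimately show ?thesis by (simp only:)
  qed
  obtain M1 E where E: "\<And>i j. (\<lambda>z. E z $ i $ j) \<in> O[sector_at_infinity](\<lambda>z. 1 / z^2)"
    and M: "\<forall>\<^sub>F z in sector_at_infinity. M z = (mat 1 + mat (1 / z) ** M1 + E z) ** tac_model s \<tau> z"
    using assms unfolding is_tac_M_def by blast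
  define M1' where "M1' = mat (of_real \<alpha>) ** R + tac_Sigma ** M1 ** tac_Sigma"
  define E' where "E' z = tac_Sigma ** E z ** tac_Sigma + mat (of_real \<alpha> / z) **
      (R ** (mat (1 / z) ** (tac_Sigma ** M1 ** tac_Sigma) + tac_Sigma ** E z ** tac_Sigma))" for z
  have SES: "(\<lambda>z. (tac_Sigma ** E z ** tac_Sigma) $ i $ j) \<in> O[sector_at_infinity](\<lambda>z. 1 / z^2)" for i j
    unfolding tac_Sigma_def diag4_eq_diag_mat diag_mat_mult_nth mult_diag_mat_nth
    using E[of i j] by (auto intro!: landau_o.big.mult_in_1 simp: mult.commute)
  have "(\<lambda>z. E' z $ i $ j) \<in> O[sector_at_infinity](\<lambda>z. 1 / z^2)" for i j
  proof -
    let ?X = "\<lambda>z. mat (1 / z) ** (tac_Sigma ** M1 ** tac_Sigma) + tac_Sigma ** E z ** tac_Sigma"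
    have X: "(\<lambda>z. ?X z $ k $ j) \<in> O[sector_at_infinity](\<lambda>z. 1 / z)" for k
    proof -
      have "(\<lambda>z. 1 / z * (tac_Sigma ** M1 ** tac_Sigma) $ k $ j) \<in> O[sector_at_infinity](\<lambda>z. 1 / z)"
        by (rule bigoI[where c = "norm ((tac_Sigma ** M1 ** tac_Sigma) $ k $ j)"]) (simp add: norm_divide)
      then show ?thesis
        unfolding vector_add_component mat_mult_nth
        by (intro sum_in_bigo(1) landau_o.big_trans[OF SES inverse_square_bigo_inverse])
    qed
    have "(\<lambda>z. (R ** ?X z) $ i $ j) \<in> O[sector_at_infinity](\<lambda>z. 1 / z)"
      unfolding matrix_matrix_mult_def[of R] using X
      by (auto intro!: big_sum_in_bigo landau_o.big.mult_in_1)
    moreover have "(\<lambda>z. of_real \<alpha> / z) \<in> O[sector_at_infinity](\<lambda>z::complex. 1 / z)"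
      by (rule bigoI[where c = "\<bar>\<alpha>\<bar>"]) (simp add: norm_divide)
    ultimately have "(\<lambda>z. of_real \<alpha> / z * (R ** ?X z) $ i $ j) \<in> O[sector_at_infinity](\<lambda>z. 1 / z * (1 / z))"
      by (rule landau_o.big.mult[rotated])
    then have "(\<lambda>z. of_real \<alpha> / z * (R ** ?X z) $ i $ j) \<in> O[sector_at_infinity](\<lambda>z. 1 / z^2)"
      by (simp add: power2_eq_square)
    moreover have "E' z $ i $ j = (tac_Sigma ** E z ** tac_Sigma) $ i $ j + of_real \<alpha> / z * (R ** ?X z) $ i $ j" for z
      unfolding E'_def by (simp only: vector_add_component mat_mult_nth[of "of_real \<alpha> / z"])
    ultimately show ?thesis
      using SES[of i j] by (simp only: sum_in_bigo(1))
  qed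
  moreover have "\<forall>\<^sub>F z in sector_at_infinity.
      L z ** tac_Sigma ** M z ** tac_Sigma = (mat 1 + mat (1 / z) ** M1' + E' z) ** tac_model s \<tau> z"
    using M
    by eventually_elim
       (simp only: L_def M1'_def E'_def tac_gauge_algebra[OF tac_Sigma_model tac_Sigma_mult_self])
  ultimately show ?thesis
    unfolding is_tac_M_def L_def[symmetric] R_def[symmetric] using deriv by blast
qed

end

end

theorem proposition5p1:
  fixes \<nu> s \<tau> \<sigma> \<alpha> :: real and q q1 :: "real \<Rightarrow> real"
  assumes "\<nu> > - 1 / 2"
    and "\<sigma> = 2 powr (2/3) * (2 * s - \<tau>^2)"
    and "hastings_mcleod \<nu> q"
    and "hastings_mcleod (\<nu> + 1) q1"
    and "\<alpha> = 2 powr (-1/3) * (q1 \<sigma> + q \<sigma>)"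
  shows "\<alpha> = 2 powr (-1/3) * (pII_u (\<nu> + 1) q1 \<sigma> - pII_u \<nu> q \<sigma>) \<and>
    2 * (q \<sigma>)^2 - 2 * deriv q \<sigma> + 2 powr (5/3) * s - 2 powr (2/3) * \<tau>^2 \<noteq> 0 \<and>
    \<alpha> = 2 powr (-1/3) * (2 * \<nu> + 1) /
      (2 * (q \<sigma>)^2 - 2 * deriv q \<sigma> + 2 powr (5/3) * s - 2 powr (2/3) * \<tau>^2) \<and>
    (\<forall>M N. is_tac_M \<nu> q s \<tau> M \<longrightarrow> is_tac_M (\<nu> + 1) q1 s \<tau> N \<longrightarrow>
      (\<forall>z. z \<notin> \<real>\<^sub>\<le>\<^sub>0 \<longrightarrow>
        N z = (mat 1 + mat (complex_of_real \<alpha> / z) ** tac_R \<nu> q s \<tau>)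
                ** tac_Sigma ** M z ** tac_Sigma))"
proof -
  interpret painleve_pair \<nu> q q1
    using assms by unfold_locales auto
  have \<sigma>: "pII_sigma s \<tau> = \<sigma>"
    by (simp add: pII_sigma_def assms(2))
  have \<alpha>: "painleve_pair.\<alpha> q q1 s \<tau> = \<alpha>"
    by (simp add: \<alpha>_def \<sigma> assms(5))
  have F: "2 * (q \<sigma>)^2 - 2 * deriv q \<sigma> + 2 powr (5/3) * s - 2 powr (2/3) * \<tau>^2 = F \<sigma>"
    using F_pII_sigma[of s \<tau>] by (simp add: \<sigma>)
  have "\<alpha> = 2 powr (-1/3) * (pII_u (\<nu> + 1) q1 \<sigma> - pII_u \<nu> q \<sigma>)"
    unfolding assms(5) pII_u_diff ..
  moreover have "F \<sigma> \<noteq> 0"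
    using F_pos[of \<sigma>] by simp
  moreover have "\<alpha> = 2 powr (-1/3) * (2 * \<nu> + 1) / F \<sigma>"
    unfolding assms(5) q_plus_q1 a_def by simp
  \<comment> \<open>The transformed \<open>M\<close> and \<open>N\<close> satisfy the same
    characterization for \<open>\<nu> + 1\<close>, so uniqueness identifies them.\<close>
  moreover have "N z = (mat 1 + mat (complex_of_real \<alpha> / z) ** tac_R \<nu> q s \<tau>) ** tac_Sigma ** M z ** tac_Sigma"
    if "is_tac_M \<nu> q s \<tau> M" "is_tac_M (\<nu> + 1) q1 s \<tau> N" "z \<notin> \<real>\<^sub>\<le>\<^sub>0" for M N z
    using is_tac_M_unique[OF is_tac_M_gauge[OF that(1)] that(2,3)] by (simp only: \<alpha>)
  ultimately show ?thesis
    unfolding F by blast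
qed

end
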